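(* Let $\Omega\subset\mathbb{R}^N$ be a bounded region and let $V:\overline\Omega\to\mathbb{C}$ be continuous. For $h>0$ let $K_h:=-h^2\Delta+V$ act in $L^2(\Omega)$ with Dirichlet boundary conditions. Then for every $\lambda\in\mathbb{C}$ with $\lambda\notin\Phi(V)$, $$\limsup_{h\to0}\|(K_h-\lambda)^{-1}\|\le\frac{1}{\operatorname{dist}(\lambda,\Phi(V))}.$$
   Context: A region in $\mathbb{R}^N$ ($N\ge1$) is a non-empty connected open set. $K_h$ is the operator sum of $-h^2\Delta$, the self-adjoint Dirichlet Laplacian on $L^2(\Omega)$ multiplied by $h^2$ (the self-adjoint operator associated with the closed form $f\mapsto h^2\int_\Omega|\nabla f|^2\,dx$ on $W_0^{1,2}(\Omega)$), and the bounded multiplication operator $V$; its domain is that of the Dirichlet Laplacian. Define $\mathrm{Ran}(V)$ to be the range of $V$ and $$\Phi(V):=\overline{\mathrm{Ran}(V)}+[0,\infty)=\{z+t:z\in\overline{\mathrm{Ran}(V)},\ t\ge0\}\subseteq\mathbb{C}.$$ Convention: $\|(K_h-\lambda)^{-1}\|:=\infty$ if $\lambda\in\mathrm{Spec}(K_h)$; otherwise it is the operator norm on $L^2(\Omega)$. Here $\operatorname{dist}$ is Euclidean distance in $\mathbb{C}$. *)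

theory Defs
  imports "HOL-Analysis.Analysis"
begin

(* Elements of L^2(Omega) are represented by square-integrable functions on R^N, whose values
   outside Omega are irrelevant.  Apart from those for test functions, the notions below respect
   equality almost everywhere in Omega, so they are notions about equivalence classes. *)

type_synonym 'n fld = "real ^ 'n \<Rightarrow> complex"

definition L2 :: "(real ^ 'n) set \<Rightarrow> 'n::finite fld set" where
  "L2 \<Omega> = {f. f \<in> borel_measurable (lebesgue_on \<Omega>)
              \<and> integrable (lebesgue_on \<Omega>) (\<lambda>x. (cmod (f x))\<^sup>2)}"

definition l2_inner :: "(real ^ 'n) set \<Rightarrow> 'n::finite fld \<Rightarrow> 'n fld \<Rightarrow> complex" where
  "l2_inner \<Omega> f g = (\<integral>x. f x * cnj (g x) \<partial>(lebesgue_on \<Omega>))"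

definition l2_norm :: "(real ^ 'n) set \<Rightarrow> 'n::finite fld \<Rightarrow> real" where
  "l2_norm \<Omega> f = sqrt (\<integral>x. (cmod (f x))\<^sup>2 \<partial>(lebesgue_on \<Omega>))"

definition ae_eq :: "(real ^ 'n) set \<Rightarrow> 'n::finite fld \<Rightarrow> 'n fld \<Rightarrow> bool" where
  "ae_eq \<Omega> f g \<longleftrightarrow> (AE x in lebesgue_on \<Omega>. f x = g x)"


definition pderiv_at :: "'n \<Rightarrow> 'n::finite fld \<Rightarrow> 'n fld" where
  "pderiv_at i f = (\<lambda>x. frechet_derivative f (at x) (axis i 1))"

(* All iterated partial derivatives are (totally) differentiable, hence continuous: this is
   membership in C^infinity(R^N). *)
definition smooth :: "'n::finite fld \<Rightarrow> bool" where
  "smooth f \<longleftrightarrow> (\<forall>js. \<forall>x. fold pderiv_at js f differentiable (at x))"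

definition test_functions :: "(real ^ 'n) set \<Rightarrow> 'n::finite fld set" where
  "test_functions \<Omega> = {\<phi>. smooth \<phi> \<and> compact (closure {x. \<phi> x \<noteq> 0})
                            \<and> closure {x. \<phi> x \<noteq> 0} \<subseteq> \<Omega>}"


definition has_weak_pderiv ::
  "(real ^ 'n) set \<Rightarrow> 'n::finite \<Rightarrow> 'n fld \<Rightarrow> 'n fld \<Rightarrow> bool" where
  "has_weak_pderiv \<Omega> i f g \<longleftrightarrow>
     (\<forall>\<phi>\<in>test_functions \<Omega>.
        (\<integral>x. f x * pderiv_at i \<phi> x \<partial>(lebesgue_on \<Omega>)) = - (\<integral>x. g x * \<phi> x \<partial>(lebesgue_on \<Omega>)))"

definition W12 :: "(real ^ 'n) set \<Rightarrow> 'n::finite fld set" where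
  "W12 \<Omega> = {f \<in> L2 \<Omega>. \<forall>i. \<exists>g\<in>L2 \<Omega>. has_weak_pderiv \<Omega> i f g}"

(* Meaningful for f in W12; the choice is unique up to equality almost everywhere. *)
definition weak_pderiv :: "(real ^ 'n) set \<Rightarrow> 'n::finite \<Rightarrow> 'n fld \<Rightarrow> 'n fld" where
  "weak_pderiv \<Omega> i f = (SOME g. g \<in> L2 \<Omega> \<and> has_weak_pderiv \<Omega> i f g)"

definition w12_norm :: "(real ^ 'n) set \<Rightarrow> 'n::finite fld \<Rightarrow> real" where
  "w12_norm \<Omega> f =
     sqrt ((l2_norm \<Omega> f)\<^sup>2 + (\<Sum>i\<in>UNIV. (l2_norm \<Omega> (weak_pderiv \<Omega> i f))\<^sup>2))"

definition W12_0 :: "(real ^ 'n) set \<Rightarrow> 'n::finite fld set" where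
  "W12_0 \<Omega> = {f \<in> W12 \<Omega>. \<exists>\<phi>::nat \<Rightarrow> 'n fld. (\<forall>k. \<phi> k \<in> test_functions \<Omega>)
                 \<and> (\<lambda>k. w12_norm \<Omega> (\<lambda>x. f x - \<phi> k x)) \<longlonglongrightarrow> 0}"

definition dirichlet_form :: "(real ^ 'n) set \<Rightarrow> 'n::finite fld \<Rightarrow> 'n fld \<Rightarrow> complex" where
  "dirichlet_form \<Omega> f u = (\<Sum>i\<in>UNIV. l2_inner \<Omega> (weak_pderiv \<Omega> i f) (weak_pderiv \<Omega> i u))"


(* Unbounded operators on L^2(Omega) are given by their graphs. *)

type_synonym 'n l2_op = "('n fld \<times> 'n fld) set"

(* The operator -Delta associated with the closed form on W12_0 (first representation theorem). *)
definition neg_dirichlet_laplacian :: "(real ^ 'n) set \<Rightarrow> 'n::finite l2_op" where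
  "neg_dirichlet_laplacian \<Omega> =
     {(f, g). f \<in> W12_0 \<Omega> \<and> g \<in> L2 \<Omega>
        \<and> (\<forall>u\<in>W12_0 \<Omega>. dirichlet_form \<Omega> f u = l2_inner \<Omega> g u)}"

definition schroedinger_op ::
  "(real ^ 'n) set \<Rightarrow> 'n::finite fld \<Rightarrow> real \<Rightarrow> 'n l2_op" where
  "schroedinger_op \<Omega> V h =
     {(f, k). k \<in> L2 \<Omega> \<and> (\<exists>g. (f, g) \<in> neg_dirichlet_laplacian \<Omega>
        \<and> ae_eq \<Omega> k (\<lambda>x. of_real (h\<^sup>2) * g x + V x * f x))}"

definition op_minus_scalar ::
  "(real ^ 'n) set \<Rightarrow> 'n::finite l2_op \<Rightarrow> complex \<Rightarrow> 'n l2_op" where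
  "op_minus_scalar \<Omega> A \<mu> =
     {(f, k). k \<in> L2 \<Omega> \<and> (\<exists>g. (f, g) \<in> A \<and> ae_eq \<Omega> k (\<lambda>x. g x - \<mu> * f x))}"

definition resolvent_set :: "(real ^ 'n) set \<Rightarrow> 'n::finite l2_op \<Rightarrow> complex set" where
  "resolvent_set \<Omega> A =
     {\<mu>. (\<forall>k\<in>L2 \<Omega>. \<exists>f. (f, k) \<in> op_minus_scalar \<Omega> A \<mu>
              \<and> (\<forall>f'. (f', k) \<in> op_minus_scalar \<Omega> A \<mu> \<longrightarrow> ae_eq \<Omega> f' f))
          \<and> (\<exists>C. \<forall>(f, k)\<in>op_minus_scalar \<Omega> A \<mu>. l2_norm \<Omega> f \<le> C * l2_norm \<Omega> k)}"

definition spec :: "(real ^ 'n) set \<Rightarrow> 'n::finite l2_op \<Rightarrow> complex set" where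
  "spec \<Omega> A = - resolvent_set \<Omega> A"

definition resolvent_norm ::
  "(real ^ 'n) set \<Rightarrow> 'n::finite l2_op \<Rightarrow> complex \<Rightarrow> ereal" where
  "resolvent_norm \<Omega> A \<mu> =
     (if \<mu> \<in> spec \<Omega> A then \<infinity>
      else SUP (f, k) \<in> {(f, k) \<in> op_minus_scalar \<Omega> A \<mu>. l2_norm \<Omega> k \<le> 1}.
             ereal (l2_norm \<Omega> f))"


definition Phi :: "(real ^ 'n) set \<Rightarrow> 'n::finite fld \<Rightarrow> complex set" where
  "Phi \<Omega> V = {z + of_real t | z t. z \<in> closure (V ` closure \<Omega>) \<and> 0 \<le> t}"

end

theory Submission
  imports Defs
begin

text \<open>Write \<open>d\<close> for the distance of \<open>\<mu>\<close> from \<open>\<Phi>(V)\<close>.  For each \<open>x\<close> the ray \<open>V(x) + [0, \<infinity>)\<close> can be separated from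
  \<open>\<mu>\<close> by a line: there is a unit vector \<open>m(x)\<close>, continuous in \<open>x\<close>, with \<open>Re m \<ge> 0\<close> and
  \<open>Re ((V - \<mu>) cnj m) \<ge> d\<close>.  By Stone--Weierstrass \<open>m\<close> may be taken polynomial at the cost of an arbitrarily
  small loss.  Testing \<open>-h\<^sup>2\<Delta>f + (V - \<mu>)f = k\<close> with \<open>m f\<close> then gives \<open>(d - O(h)) |f| \<le> (1 + O(h)) |k|\<close>, where the
  error comes from \<open>h\<^sup>2 \<langle>\<nabla>f, f \<nabla>m\<rangle>\<close> and is controlled by the bound on \<open>h |\<nabla>f|\<close> obtained by testing with \<open>f\<close>.
  Both estimates are uniform when \<open>\<mu>\<close> is replaced by \<open>\<mu> - s\<close>, \<open>s \<ge> 0\<close>; since the equation is solvable for large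
  \<open>s\<close> (Riesz representation and a contraction), solvability propagates in steps of fixed length to \<open>s = 0\<close>.\<close>

section \<open>The space \<open>L\<^sup>2(\<Omega>)\<close>\<close>

text \<open>\<open>Phi \<Omega> V\<close> is in general not convex. Testing with one fixed rotation
  of \<open>f\<close> compares \<open>\<mu>\<close> only with a half-plane containing the whole set,
  which sees no more than its convex hull. So the direction must vary with the point, and its
  derivative is what the smallness of \<open>h\<close> has to pay for. The natural direction field
  is as rough as \<open>V\<close>, that is, merely continuous; the polynomial replacing it is fixed
  before \<open>h\<close>, so its gradient bound stays constant as \<open>h\<close> tends to 0.

  The sign Re m \<ge> 0 does two jobs: it makes the leading term Re <\<nabla>f, m \<nabla>f>
  nonnegative, and it lets a shift by s \<ge> 0 contribute s Re m |f|^2 \<ge> 0. Both express that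
  [0, \<infinity>) is added to the range in \<open>Phi\<close>.

  The a priori estimate gives injectivity, but the operator is not self-adjoint for complex
  \<open>V\<close>, so surjectivity needs its own argument: the continuation in s. Nothing is asked
  of the boundary of \<Omega>; all facts about \<open>W12_0\<close> come from approximation by test
  functions.\<close>

lemma borel_measurable_cnj_compose [measurable (raw)]:
  assumes "f \<in> borel_measurable M"
  shows "(\<lambda>x. cnj (f x)) \<in> borel_measurable M"
  using measurable_compose[OF assms borel_measurable_continuous_onI[OF continuous_on_cnj[OF continuous_on_id]]]
  by simp

lemma L2_measurable [measurable_dest]: "f \<in> L2 \<Omega> \<Longrightarrow> f \<in> borel_measurable (lebesgue_on \<Omega>)"
  by (simp add: L2_def)

lemma L2_integrable_square: "f \<in> L2 \<Omega> \<Longrightarrow> integrable (lebesgue_on \<Omega>) (\<lambda>x. (cmod (f x))\<^sup>2)"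
  by (simp add: L2_def)

lemma L2_integrable_norm_mult:
  assumes "f \<in> L2 \<Omega>" "g \<in> L2 \<Omega>"
  shows "integrable (lebesgue_on \<Omega>) (\<lambda>x. cmod (f x) * cmod (g x))"
proof (rule Bochner_Integration.integrable_bound)
  show "integrable (lebesgue_on \<Omega>) (\<lambda>x. (cmod (f x))\<^sup>2 + (cmod (g x))\<^sup>2)"
    using assms by (simp add: L2_integrable_square)
  show "(\<lambda>x. cmod (f x) * cmod (g x)) \<in> borel_measurable (lebesgue_on \<Omega>)"
    using assms[THEN L2_measurable] by measurable
  have "a * b \<le> a\<^sup>2 + b\<^sup>2" if "a \<ge> 0" "b \<ge> 0" for a b :: real
    using sum_squares_bound[of a b] mult_nonneg_nonneg[OF that] by linarith
  then show "AE x in lebesgue_on \<Omega>. norm (cmod (f x) * cmod (g x)) \<le> norm ((cmod (f x))\<^sup>2 + (cmod (g x))\<^sup>2)"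
    by (intro AE_I2) (simp add: abs_mult)
qed

lemma L2_integrable_mult:
  assumes "f \<in> L2 \<Omega>" "g \<in> L2 \<Omega>"
  shows "integrable (lebesgue_on \<Omega>) (\<lambda>x. f x * g x)"
  using assms[THEN L2_measurable]
  by (intro Bochner_Integration.integrable_bound[OF L2_integrable_norm_mult[OF assms]])
     (auto simp: norm_mult)

lemma L2_cnj: "f \<in> L2 \<Omega> \<Longrightarrow> (\<lambda>x. cnj (f x)) \<in> L2 \<Omega>"
  by (auto simp: L2_def)

lemma L2_integrable_inner:
  assumes "f \<in> L2 \<Omega>" "g \<in> L2 \<Omega>"
  shows "integrable (lebesgue_on \<Omega>) (\<lambda>x. f x * cnj (g x))"
  using L2_integrable_mult[OF assms(1) L2_cnj[OF assms(2)]] .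

text \<open>The bound is asked for on \<Omega> only: the multipliers used later are polynomials,
  unbounded on the whole space.\<close>

lemma L2_mult_bounded:
  assumes "f \<in> L2 \<Omega>" and [measurable]: "m \<in> borel_measurable (lebesgue_on \<Omega>)"
    and "\<And>x. x \<in> \<Omega> \<Longrightarrow> cmod (m x) \<le> C"
  shows "(\<lambda>x. m x * f x) \<in> L2 \<Omega>"
proof -
  note [measurable] = L2_measurable[OF assms(1)]
  have "integrable (lebesgue_on \<Omega>) (\<lambda>x. (cmod (m x * f x))\<^sup>2)"
  proof (rule Bochner_Integration.integrable_bound)
    show "integrable (lebesgue_on \<Omega>) (\<lambda>x. C\<^sup>2 * (cmod (f x))\<^sup>2)"
      using assms by (simp add: L2_integrable_square)
    show "AE x in lebesgue_on \<Omega>. norm ((cmod (m x * f x))\<^sup>2) \<le> norm (C\<^sup>2 * (cmod (f x))\<^sup>2)"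
      by (intro AE_I2) (auto simp: norm_mult power_mult_distrib intro!: mult_right_mono power_mono assms)
  qed measurable
  then show ?thesis by (simp add: L2_def)
qed

lemma L2_add:
  assumes "f \<in> L2 \<Omega>" "g \<in> L2 \<Omega>"
  shows "(\<lambda>x. f x + g x) \<in> L2 \<Omega>"
proof -
  note [measurable] = assms[THEN L2_measurable]
  have "integrable (lebesgue_on \<Omega>) (\<lambda>x. (cmod (f x + g x))\<^sup>2)"
  proof (rule Bochner_Integration.integrable_bound)
    show "integrable (lebesgue_on \<Omega>) (\<lambda>x. (cmod (f x))\<^sup>2 + (cmod (g x))\<^sup>2 + 2 * (cmod (f x) * cmod (g x)))"
      using assms by (simp add: L2_integrable_square L2_integrable_norm_mult)
    have "(cmod (f x + g x))\<^sup>2 \<le> (cmod (f x) + cmod (g x))\<^sup>2" for x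
      by (intro power_mono norm_triangle_ineq) simp
    then show "AE x in lebesgue_on \<Omega>. norm ((cmod (f x + g x))\<^sup>2) \<le>
       norm ((cmod (f x))\<^sup>2 + (cmod (g x))\<^sup>2 + 2 * (cmod (f x) * cmod (g x)))"
      by (intro AE_I2) (simp add: power2_sum algebra_simps)
  qed measurable
  then show ?thesis by (simp add: L2_def)
qed

lemma L2_cmult: "f \<in> L2 \<Omega> \<Longrightarrow> (\<lambda>x. c * f x) \<in> L2 \<Omega>"
  by (rule L2_mult_bounded[where C="cmod c"]) auto

lemma L2_diff: "f \<in> L2 \<Omega> \<Longrightarrow> g \<in> L2 \<Omega> \<Longrightarrow> (\<lambda>x. f x - g x) \<in> L2 \<Omega>"
  using L2_add[of f \<Omega> "\<lambda>x. (-1) * g x"] L2_cmult[of g \<Omega> "-1"] by simp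

lemma L2_zero: "(\<lambda>x. 0) \<in> L2 \<Omega>"
  by (simp add: L2_def)

section \<open>Norm and inner product, up to equality almost everywhere\<close>

lemma l2_norm_nonneg [simp]: "0 \<le> l2_norm \<Omega> f"
  by (simp add: l2_norm_def)

lemma l2_norm_square: "(l2_norm \<Omega> f)\<^sup>2 = (\<integral>x. (cmod (f x))\<^sup>2 \<partial>(lebesgue_on \<Omega>))"
  by (simp add: l2_norm_def)

lemma l2_inner_self: "f \<in> L2 \<Omega> \<Longrightarrow> l2_inner \<Omega> f f = complex_of_real ((l2_norm \<Omega> f)\<^sup>2)"
  by (simp add: l2_norm_square l2_inner_def flip: integral_complex_of_real complex_norm_square)

lemma l2_norm_cong:
  assumes "ae_eq \<Omega> f g" "f \<in> L2 \<Omega>" "g \<in> L2 \<Omega>"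
  shows "l2_norm \<Omega> f = l2_norm \<Omega> g"
proof -
  note [measurable] = assms(2,3)[THEN L2_measurable]
  show ?thesis unfolding l2_norm_def
    by (rule arg_cong[where f=sqrt], rule integral_cong_AE)
       (use assms(1) in \<open>auto simp: ae_eq_def elim: AE_mp\<close>)
qed

lemma l2_inner_cong:
  assumes "ae_eq \<Omega> f f'" "ae_eq \<Omega> g g'" "f \<in> L2 \<Omega>" "g \<in> L2 \<Omega>" "f' \<in> L2 \<Omega>" "g' \<in> L2 \<Omega>"
  shows "l2_inner \<Omega> f g = l2_inner \<Omega> f' g'"
proof -
  note [measurable] = assms(3-6)[THEN L2_measurable]
  have "AE x in lebesgue_on \<Omega>. f x * cnj (g x) = f' x * cnj (g' x)"
    using assms(1,2) unfolding ae_eq_def by (auto elim: AE_mp)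
  then show ?thesis unfolding l2_inner_def
    by (intro integral_cong_AE) auto
qed

lemma ae_eq_refl [simp]: "ae_eq \<Omega> f f"
  by (simp add: ae_eq_def)

lemma l2_inner_add_left:
  "f \<in> L2 \<Omega> \<Longrightarrow> g \<in> L2 \<Omega> \<Longrightarrow> u \<in> L2 \<Omega> \<Longrightarrow> l2_inner \<Omega> (\<lambda>x. f x + g x) u = l2_inner \<Omega> f u + l2_inner \<Omega> g u"
  by (simp add: l2_inner_def distrib_right L2_integrable_inner)

lemma l2_inner_diff_left:
  "f \<in> L2 \<Omega> \<Longrightarrow> g \<in> L2 \<Omega> \<Longrightarrow> u \<in> L2 \<Omega> \<Longrightarrow> l2_inner \<Omega> (\<lambda>x. f x - g x) u = l2_inner \<Omega> f u - l2_inner \<Omega> g u"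
  by (simp add: l2_inner_def left_diff_distrib L2_integrable_inner)

lemma l2_inner_add_right:
  "f \<in> L2 \<Omega> \<Longrightarrow> g \<in> L2 \<Omega> \<Longrightarrow> u \<in> L2 \<Omega> \<Longrightarrow> l2_inner \<Omega> u (\<lambda>x. f x + g x) = l2_inner \<Omega> u f + l2_inner \<Omega> u g"
  by (simp add: l2_inner_def distrib_left L2_integrable_inner)

lemma l2_inner_cmult_left: "l2_inner \<Omega> (\<lambda>x. c * f x) u = c * l2_inner \<Omega> f u"
  by (simp add: l2_inner_def mult.assoc)

lemma l2_inner_cmult_right: "l2_inner \<Omega> u (\<lambda>x. c * f x) = cnj c * l2_inner \<Omega> u f"
  by (simp add: l2_inner_def mult.left_commute)

lemma l2_inner_commute: "l2_inner \<Omega> g f = cnj (l2_inner \<Omega> f g)"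
  unfolding l2_inner_def by (simp add: mult.commute flip: Bochner_Integration.integral_cnj)

text \<open>Cauchy-Schwarz for nonnegative integrals, transferred to the moduli. In this form it
  gives the bound on the inner product, the triangle inequality and, paired with the constant 1, the
  comparison of L^1 and L^2 norms.\<close>

lemma L2_norm_mult_le:
  assumes "f \<in> L2 \<Omega>" "g \<in> L2 \<Omega>"
  shows "(\<integral>x. cmod (f x) * cmod (g x) \<partial>(lebesgue_on \<Omega>)) \<le> l2_norm \<Omega> f * l2_norm \<Omega> g"
proof -
  note [measurable] = assms[THEN L2_measurable]
  let ?M = "lebesgue_on \<Omega>" let ?I = "\<integral>x. cmod (f x) * cmod (g x) \<partial>?M"
  have "(\<integral>\<^sup>+x. ennreal (cmod (f x)) * ennreal (cmod (g x)) \<partial>?M)\<^sup>2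
     \<le> (\<integral>\<^sup>+x. (ennreal (cmod (f x)))\<^sup>2 \<partial>?M) * (\<integral>\<^sup>+x. (ennreal (cmod (g x)))\<^sup>2 \<partial>?M)"
    by (rule Cauchy_Schwarz_nn_integral) auto
  moreover have "(\<integral>\<^sup>+x. ennreal (cmod (f x)) * ennreal (cmod (g x)) \<partial>?M) = ennreal ?I"
    using L2_integrable_norm_mult[OF assms]
    by (simp add: nn_integral_eq_integral flip: ennreal_mult)
  moreover have "(\<integral>\<^sup>+x. (ennreal (cmod (u x)))\<^sup>2 \<partial>?M) = ennreal ((l2_norm \<Omega> u)\<^sup>2)" if "u \<in> L2 \<Omega>" for u
    using L2_integrable_square[OF that]
    by (simp add: ennreal_power nn_integral_eq_integral l2_norm_square)
  ultimately have "ennreal (?I\<^sup>2) \<le> ennreal ((l2_norm \<Omega> f * l2_norm \<Omega> g)\<^sup>2)"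
    using assms by (simp add: ennreal_power ennreal_mult power_mult_distrib)
  then have "?I\<^sup>2 \<le> (l2_norm \<Omega> f * l2_norm \<Omega> g)\<^sup>2"
    by (subst (asm) ennreal_le_iff) auto
  then show ?thesis
    by (rule power2_le_imp_le) simp
qed

lemma l2_Cauchy_Schwarz:
  assumes "f \<in> L2 \<Omega>" "g \<in> L2 \<Omega>"
  shows "cmod (l2_inner \<Omega> f g) \<le> l2_norm \<Omega> f * l2_norm \<Omega> g"
proof -
  have "cmod (l2_inner \<Omega> f g) \<le> (\<integral>x. cmod (f x * cnj (g x)) \<partial>(lebesgue_on \<Omega>))"
    unfolding l2_inner_def by (rule integral_norm_bound)
  then show ?thesis
    using L2_norm_mult_le[OF assms] by (simp add: norm_mult)
qed

lemma l2_norm_triangle: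
  assumes "f \<in> L2 \<Omega>" "g \<in> L2 \<Omega>"
  shows "l2_norm \<Omega> (\<lambda>x. f x + g x) \<le> l2_norm \<Omega> f + l2_norm \<Omega> g"
proof (rule power2_le_imp_le)
  have "(l2_norm \<Omega> (\<lambda>x. f x + g x))\<^sup>2 \<le>
      (\<integral>x. (cmod (f x))\<^sup>2 + (cmod (g x))\<^sup>2 + 2 * (cmod (f x) * cmod (g x)) \<partial>(lebesgue_on \<Omega>))"
    unfolding l2_norm_square
  proof (rule integral_mono)
    show "integrable (lebesgue_on \<Omega>) (\<lambda>x. (cmod (f x + g x))\<^sup>2)"
      using L2_add[OF assms] by (rule L2_integrable_square)
    show "integrable (lebesgue_on \<Omega>) (\<lambda>x. (cmod (f x))\<^sup>2 + (cmod (g x))\<^sup>2 + 2 * (cmod (f x) * cmod (g x)))"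
      using assms by (simp add: L2_integrable_square L2_integrable_norm_mult)
    have "(cmod (f x + g x))\<^sup>2 \<le> (cmod (f x) + cmod (g x))\<^sup>2" for x
      by (intro power_mono norm_triangle_ineq) simp
    then show "(cmod (f x + g x))\<^sup>2 \<le> (cmod (f x))\<^sup>2 + (cmod (g x))\<^sup>2 + 2 * (cmod (f x) * cmod (g x))" for x
      by (simp add: power2_sum algebra_simps)
  qed
  also have "\<dots> = (l2_norm \<Omega> f)\<^sup>2 + (l2_norm \<Omega> g)\<^sup>2 + 2 * (\<integral>x. cmod (f x) * cmod (g x) \<partial>(lebesgue_on \<Omega>))"
    using assms by (simp add: l2_norm_square L2_integrable_square L2_integrable_norm_mult)
  also have "\<dots> \<le> (l2_norm \<Omega> f + l2_norm \<Omega> g)\<^sup>2"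
    using L2_norm_mult_le[OF assms] by (simp add: power2_sum)
  finally show "(l2_norm \<Omega> (\<lambda>x. f x + g x))\<^sup>2 \<le> (l2_norm \<Omega> f + l2_norm \<Omega> g)\<^sup>2" .
qed simp

lemma l2_norm_cmult: "l2_norm \<Omega> (\<lambda>x. c * f x) = cmod c * l2_norm \<Omega> f"
  by (simp add: l2_norm_def norm_mult power_mult_distrib real_sqrt_mult)

lemma l2_norm_minus_commute: "l2_norm \<Omega> (\<lambda>x. f x - g x) = l2_norm \<Omega> (\<lambda>x. g x - f x)"
  by (simp add: l2_norm_def norm_minus_commute)

lemma l2_norm_triangle_diff:
  assumes "f \<in> L2 \<Omega>" "g \<in> L2 \<Omega>" "u \<in> L2 \<Omega>"
  shows "l2_norm \<Omega> (\<lambda>x. f x - u x) \<le> l2_norm \<Omega> (\<lambda>x. f x - g x) + l2_norm \<Omega> (\<lambda>x. g x - u x)"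
  using l2_norm_triangle[OF L2_diff[OF assms(1,2)] L2_diff[OF assms(2,3)]] by simp

lemma l2_norm_mult_le:
  assumes "f \<in> L2 \<Omega>" "m \<in> borel_measurable (lebesgue_on \<Omega>)"
    and "\<And>x. x \<in> \<Omega> \<Longrightarrow> cmod (m x) \<le> C" "0 \<le> C"
  shows "l2_norm \<Omega> (\<lambda>x. m x * f x) \<le> C * l2_norm \<Omega> f"
proof (rule power2_le_imp_le)
  have "(l2_norm \<Omega> (\<lambda>x. m x * f x))\<^sup>2 \<le> (\<integral>x. C\<^sup>2 * (cmod (f x))\<^sup>2 \<partial>(lebesgue_on \<Omega>))"
    unfolding l2_norm_square
    using L2_integrable_square[OF L2_mult_bounded[OF assms(1-3)]] L2_integrable_square[OF assms(1)]
    by (intro integral_mono)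
       (auto simp: norm_mult power_mult_distrib intro!: mult_right_mono power_mono assms)
  then show "(l2_norm \<Omega> (\<lambda>x. m x * f x))\<^sup>2 \<le> (C * l2_norm \<Omega> f)\<^sup>2"
    by (simp add: power_mult_distrib l2_norm_square)
qed (use assms in simp)

lemma l2_norm_eq_0_iff:
  assumes "f \<in> L2 \<Omega>"
  shows "l2_norm \<Omega> f = 0 \<longleftrightarrow> ae_eq \<Omega> f (\<lambda>x. 0)"
  using integral_nonneg_eq_0_iff_AE[OF L2_integrable_square[OF assms]]
  by (simp add: l2_norm_def ae_eq_def)

lemma l2_norm_diff_eq_0_iff:
  assumes "f \<in> L2 \<Omega>" "g \<in> L2 \<Omega>"
  shows "l2_norm \<Omega> (\<lambda>x. f x - g x) = 0 \<longleftrightarrow> ae_eq \<Omega> f g"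
  using l2_norm_eq_0_iff[OF L2_diff[OF assms]] by (simp add: ae_eq_def)

lemma l2_inner_tendsto:
  assumes "\<And>n. f n \<in> L2 \<Omega>" "g \<in> L2 \<Omega>" "u \<in> L2 \<Omega>"
    and "(\<lambda>n. l2_norm \<Omega> (\<lambda>x. f n x - g x)) \<longlonglongrightarrow> 0"
  shows "(\<lambda>n. l2_inner \<Omega> (f n) u) \<longlonglongrightarrow> l2_inner \<Omega> g u"
proof -
  have "(\<lambda>n. l2_inner \<Omega> (f n) u - l2_inner \<Omega> g u) \<longlonglongrightarrow> 0"
  proof (rule Lim_null_comparison)
    show "(\<lambda>n. l2_norm \<Omega> (\<lambda>x. f n x - g x) * l2_norm \<Omega> u) \<longlonglongrightarrow> 0"
      using tendsto_mult_left_zero[OF assms(4)] .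
    show "\<forall>\<^sub>F n in sequentially. norm (l2_inner \<Omega> (f n) u - l2_inner \<Omega> g u)
        \<le> l2_norm \<Omega> (\<lambda>x. f n x - g x) * l2_norm \<Omega> u"
      using assms l2_Cauchy_Schwarz[OF L2_diff[OF assms(1,2)] assms(3)]
      by (simp add: l2_inner_diff_left)
  qed
  then show ?thesis by (simp add: LIM_zero_iff)
qed

lemma l2_inner_tendsto_right:
  assumes "\<And>n. f n \<in> L2 \<Omega>" "g \<in> L2 \<Omega>" "u \<in> L2 \<Omega>"
    and "(\<lambda>n. l2_norm \<Omega> (\<lambda>x. f n x - g x)) \<longlonglongrightarrow> 0"
  shows "(\<lambda>n. l2_inner \<Omega> u (f n)) \<longlonglongrightarrow> l2_inner \<Omega> u g"
  using tendsto_cnj[OF l2_inner_tendsto[OF assms]] by (simp add: l2_inner_commute[of _ u])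

text \<open>Riesz--Fischer.  Since \<open>\<Omega>\<close> has finite measure, \<open>L\<^sup>2\<close>-Cauchy sequences are \<open>L\<^sup>1\<close>-Cauchy and
  have a subsequence converging almost everywhere; Fatou's lemma then gives \<open>L\<^sup>2\<close>-convergence.\<close>

lemma L2_complete:
  fixes f :: "nat \<Rightarrow> 'n::finite fld"
  assumes fin: "finite_measure (lebesgue_on \<Omega>)"
    and f: "\<And>n. f n \<in> L2 \<Omega>"
    and Cauchy: "\<And>e. e > 0 \<Longrightarrow> \<exists>N. \<forall>m\<ge>N. \<forall>n\<ge>N. l2_norm \<Omega> (\<lambda>x. f m x - f n x) < e"
  obtains g where "g \<in> L2 \<Omega>" "(\<lambda>n. l2_norm \<Omega> (\<lambda>x. f n x - g x)) \<longlonglongrightarrow> 0"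
proof -
  let ?M = "lebesgue_on \<Omega>"
  interpret finite_measure ?M by (rule fin)
  note [measurable] = f[THEN L2_measurable]
  have one: "(\<lambda>x. 1) \<in> L2 \<Omega>" by (simp add: L2_def)
  have int: "integrable ?M (f n)" for n
    using L2_integrable_mult[OF f one] by simp
  obtain C where C: "C = l2_norm \<Omega> (\<lambda>x. 1)" "C \<ge> 0" by simp
  obtain r where r: "strict_mono r" "AE x in ?M. Cauchy (\<lambda>i. f (r i) x)"
  proof (rule cauchy_L1_AE_cauchy_subseq[of ?M f])
    fix e :: real assume e: "e > 0"
    \<comment> \<open>\<open>C\<close> is the norm of the constant 1, so L^1 distances are at most
      \<open>C\<close> times L^2 distances; \<open>C + 1\<close> keeps the divisor positive on a
      null domain.\<close>
    obtain N where N: "\<And>m n. m \<ge> N \<Longrightarrow> n \<ge> N \<Longrightarrow> l2_norm \<Omega> (\<lambda>x. f m x - f n x) < e / (C + 1)"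
      using Cauchy[of "e / (C+1)"] e C by (metis add_nonneg_pos divide_pos_pos zero_less_one)
    have "(\<integral>x. norm (f i x - f j x) \<partial>?M) < e" if "i \<ge> N" "j \<ge> N" for i j
    proof -
      have "(\<integral>x. norm (f i x - f j x) \<partial>?M) \<le> l2_norm \<Omega> (\<lambda>x. f i x - f j x) * C"
        using L2_norm_mult_le[OF L2_diff[OF f f] one] C by simp
      also have "\<dots> \<le> l2_norm \<Omega> (\<lambda>x. f i x - f j x) * (C + 1)"
        by (intro mult_left_mono) auto
      also have "\<dots> < e / (C + 1) * (C + 1)"
        using N[OF that] C(2) by (intro mult_strict_right_mono) linarith+
      finally show ?thesis using C by simp
    qed
    then show "\<exists>N. \<forall>i\<ge>N. \<forall>j\<ge>N. (\<integral>x. norm (f i x - f j x) \<partial>?M) < e" by blast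
  qed (use int in auto)
  define g where "g x = lim (\<lambda>i. f (r i) x)" for x
  have [measurable]: "g \<in> borel_measurable ?M"
    unfolding g_def by measurable
  have lim: "AE x in ?M. (\<lambda>i. f (r i) x) \<longlonglongrightarrow> g x"
    using r(2) by eventually_elim (simp add: g_def Cauchy_convergent_iff convergent_LIMSEQ_iff)
  \<comment> \<open>Fatou is applied with \<open>m\<close> fixed and only the second index running
    along the subsequence \<open>r\<close>, so the conclusion covers the full sequence.\<close>
  have key: "integrable ?M (\<lambda>x. (cmod (f m x - g x))\<^sup>2) \<and> l2_norm \<Omega> (\<lambda>x. f m x - g x) \<le> e"
    if N: "\<And>n. n \<ge> N \<Longrightarrow> l2_norm \<Omega> (\<lambda>x. f m x - f n x) < e" and e: "e > 0" for m N e
  proof -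
    have "(\<integral>\<^sup>+x. ennreal ((cmod (f m x - g x))\<^sup>2) \<partial>?M)
        \<le> (\<integral>\<^sup>+x. liminf (\<lambda>i. ennreal ((cmod (f m x - f (r i) x))\<^sup>2)) \<partial>?M)"
    proof (rule nn_integral_mono_AE)
      show "AE x in ?M. ennreal ((cmod (f m x - g x))\<^sup>2) \<le> liminf (\<lambda>i. ennreal ((cmod (f m x - f (r i) x))\<^sup>2))"
        using lim
      proof eventually_elim
        case (elim x)
        have "(\<lambda>i. ennreal ((cmod (f m x - f (r i) x))\<^sup>2)) \<longlonglongrightarrow> ennreal ((cmod (f m x - g x))\<^sup>2)"
          by (intro tendsto_intros elim)
        then show ?case
            using lim_imp_Liminf[OF trivial_limit_sequentially] by fastforce
      qed
    qed
    also have "\<dots> \<le> liminf (\<lambda>i. \<integral>\<^sup>+x. ennreal ((cmod (f m x - f (r i) x))\<^sup>2) \<partial>?M)"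
      by (rule nn_integral_liminf) measurable
    also have "\<dots> = liminf (\<lambda>i. ennreal ((l2_norm \<Omega> (\<lambda>x. f m x - f (r i) x))\<^sup>2))"
      by (simp add: l2_norm_square nn_integral_eq_integral[OF L2_integrable_square[OF L2_diff[OF f f]]])
    also have "\<dots> \<le> ennreal (e\<^sup>2)"
    proof -
      have "\<forall>\<^sub>F i in sequentially. ennreal ((l2_norm \<Omega> (\<lambda>x. f m x - f (r i) x))\<^sup>2) \<le> ennreal (e\<^sup>2)"
        using eventually_ge_at_top[of N]
      proof eventually_elim
        case (elim i)
        then have "r i \<ge> N" using seq_suble[OF r(1), of i] by simp
        then show ?case using N[of "r i"] e by (intro ennreal_leI power_mono) auto
      qed
      then have "liminf (\<lambda>i. ennreal ((l2_norm \<Omega> (\<lambda>x. f m x - f (r i) x))\<^sup>2)) \<le> liminf (\<lambda>i. ennreal (e\<^sup>2))"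
        by (rule Liminf_mono)
      then show ?thesis by (simp add: Liminf_const)
    qed
    finally have le: "(\<integral>\<^sup>+x. ennreal ((cmod (f m x - g x))\<^sup>2) \<partial>?M) \<le> ennreal (e\<^sup>2)" .
    have i: "integrable ?M (\<lambda>x. (cmod (f m x - g x))\<^sup>2)"
      by (rule integrableI_nonneg) (use le in \<open>auto intro: le_less_trans\<close>)
    have "(l2_norm \<Omega> (\<lambda>x. f m x - g x))\<^sup>2 \<le> e\<^sup>2"
      using le by (simp add: nn_integral_eq_integral[OF i] l2_norm_square)
    then show ?thesis using i e by (auto intro: power2_le_imp_le)
  qed
  show ?thesis
  proof
    obtain N where N: "\<forall>m\<ge>N. \<forall>n\<ge>N. l2_norm \<Omega> (\<lambda>x. f m x - f n x) < 1"
      using Cauchy[of 1] by auto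
    then have "(\<lambda>x. f N x - g x) \<in> L2 \<Omega>"
      using key[of N N 1] by (simp add: L2_def)
    from L2_diff[OF f[of N] this] show "g \<in> L2 \<Omega>" by simp
    show "(\<lambda>n. l2_norm \<Omega> (\<lambda>x. f n x - g x)) \<longlonglongrightarrow> 0"
    proof (rule LIMSEQ_I)
      fix e :: real assume "e > 0"
      then obtain N where N: "\<forall>m\<ge>N. \<forall>n\<ge>N. l2_norm \<Omega> (\<lambda>x. f m x - f n x) < e/2"
        using Cauchy[of "e/2"] by auto
      then have "l2_norm \<Omega> (\<lambda>x. f n x - g x) < e" if "n \<ge> N" for n
        using key[of N n "e/2"] that \<open>e > 0\<close> by fastforce
      then show "\<exists>no. \<forall>n\<ge>no. norm (l2_norm \<Omega> (\<lambda>x. f n x - g x) - 0) < e" by auto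
    qed
  qed
qed

section \<open>Smooth functions and test functions\<close>

lemma pderiv_at_eq:
  "(f has_derivative f') (at x) \<Longrightarrow> pderiv_at i f x = f' (axis i 1)"
  by (simp add: pderiv_at_def frechet_derivative_at[symmetric])

lemma pderiv_at_add:
  assumes "\<And>x. f differentiable (at x)" "\<And>x. g differentiable (at x)"
  shows "pderiv_at i (\<lambda>x. f x + g x) = (\<lambda>x. pderiv_at i f x + pderiv_at i g x)"
proof
  fix x
  show "pderiv_at i (\<lambda>x. f x + g x) x = pderiv_at i f x + pderiv_at i g x"
    using pderiv_at_eq[OF has_derivative_add[OF assms[THEN frechet_derivative_works[THEN iffD1]]]]
    by (simp add: pderiv_at_def)
qed

lemma pderiv_at_mult:
  assumes "\<And>x. f differentiable (at x)" "\<And>x. g differentiable (at x)"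
  shows "pderiv_at i (\<lambda>x. f x * g x) = (\<lambda>x. f x * pderiv_at i g x + pderiv_at i f x * g x)"
proof
  fix x
  show "pderiv_at i (\<lambda>x. f x * g x) x = f x * pderiv_at i g x + pderiv_at i f x * g x"
    using pderiv_at_eq[OF has_derivative_mult[OF assms[THEN frechet_derivative_works[THEN iffD1]]]]
    by (simp add: pderiv_at_def)
qed

lemma pderiv_at_const [simp]: "pderiv_at i (\<lambda>x. c) = (\<lambda>x. 0)"
  by (simp add: pderiv_at_def)

text \<open>By the Leibniz rule, differentiating a product yields products of other factors. An
  induction on the order with arbitrary functions handles this, so the order is made explicit. The
  recursion removes the first derivative taken, as \<open>fold\<close> does.\<close>

primrec differentiable_upto :: "nat \<Rightarrow> 'n::finite fld \<Rightarrow> bool" where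
  "differentiable_upto 0 f \<longleftrightarrow> (\<forall>x. f differentiable (at x))"
| "differentiable_upto (Suc k) f \<longleftrightarrow>
     (\<forall>x. f differentiable (at x)) \<and> (\<forall>i. differentiable_upto k (pderiv_at i f))"

lemma differentiable_upto_iff:
  "differentiable_upto k f \<longleftrightarrow> (\<forall>js. length js \<le> k \<longrightarrow> (\<forall>x. fold pderiv_at js f differentiable (at x)))"
proof (induction k arbitrary: f)
  case (Suc k)
  have "(\<forall>js. length js \<le> Suc k \<longrightarrow> P js) \<longleftrightarrow> P [] \<and> (\<forall>j js. length js \<le> k \<longrightarrow> P (j # js))"
    for P :: "'a list \<Rightarrow> bool"
    by (metis Suc_le_mono length_Cons list.exhaust list.size(3) zero_le)
  from this[of "\<lambda>js. \<forall>x. fold pderiv_at js f differentiable (at x)"] show ?case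
    by (simp add: Suc)
qed auto

lemma smooth_iff_differentiable_upto: "smooth f \<longleftrightarrow> (\<forall>k. differentiable_upto k f)"
  by (auto simp: smooth_def differentiable_upto_iff)

lemma differentiable_upto_SucD: "differentiable_upto (Suc k) f \<Longrightarrow> differentiable_upto k f"
  by (simp add: differentiable_upto_iff)

lemma differentiable_uptoD: "differentiable_upto k f \<Longrightarrow> f differentiable (at x)"
  by (cases k) auto

lemma differentiable_upto_add:
  "differentiable_upto k f \<Longrightarrow> differentiable_upto k g \<Longrightarrow> differentiable_upto k (\<lambda>x. f x + g x)"
  by (induction k arbitrary: f g) (auto simp: pderiv_at_add)

lemma differentiable_upto_mult:
  "differentiable_upto k f \<Longrightarrow> differentiable_upto k g \<Longrightarrow> differentiable_upto k (\<lambda>x. f x * g x)"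
proof (induction k arbitrary: f g)
  case (Suc k)
  from Suc show ?case
    using Suc.prems[THEN differentiable_upto_SucD]
    by (auto simp: pderiv_at_mult intro!: differentiable_upto_add)
qed auto

lemma differentiable_upto_const: "differentiable_upto k (\<lambda>x. c)"
  by (induction k arbitrary: c) auto

lemma smooth_add: "smooth f \<Longrightarrow> smooth g \<Longrightarrow> smooth (\<lambda>x. f x + g x)"
  by (simp add: smooth_iff_differentiable_upto differentiable_upto_add)

lemma smooth_mult: "smooth f \<Longrightarrow> smooth g \<Longrightarrow> smooth (\<lambda>x. f x * g x)"
  by (simp add: smooth_iff_differentiable_upto differentiable_upto_mult)

lemma smooth_const: "smooth (\<lambda>x. c)"
  by (simp add: smooth_iff_differentiable_upto differentiable_upto_const)

lemma smooth_prod: "finite I \<Longrightarrow> (\<And>i. i \<in> I \<Longrightarrow> smooth (f i)) \<Longrightarrow> smooth (\<lambda>x. \<Prod>i\<in>I. f i x)"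
  by (induction I rule: finite_induct) (auto intro: smooth_mult smooth_const)

lemma smooth_pderiv_at: "smooth f \<Longrightarrow> smooth (pderiv_at i f)"
  unfolding smooth_iff_differentiable_upto using differentiable_upto.simps(2) by blast

lemma smooth_differentiable: "smooth f \<Longrightarrow> f differentiable (at x)"
  using differentiable_uptoD smooth_iff_differentiable_upto by blast

lemma smooth_has_derivative: "smooth f \<Longrightarrow> (f has_derivative frechet_derivative f (at x)) (at x)"
  by (simp add: smooth_differentiable flip: frechet_derivative_works)

lemma smooth_continuous_on: "smooth f \<Longrightarrow> continuous_on S f"
  by (meson continuous_at_imp_continuous_on differentiable_imp_continuous_within smooth_differentiable)

lemma smooth_of_real_bounded_linear:
  assumes "bounded_linear l"
  shows "smooth (\<lambda>x. complex_of_real (l x))"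
proof -
  have d: "((\<lambda>x. complex_of_real (l x)) has_derivative (\<lambda>x. complex_of_real (l x))) (at x)" for x
    by (intro bounded_linear_imp_has_derivative bounded_linear_compose[OF bounded_linear_of_real assms])
  have "differentiable_upto k (\<lambda>x. complex_of_real (l x))" for k
  proof (cases k)
    case 0 then show ?thesis using d by (auto simp: differentiable_def)
  next
    case (Suc k)
    have "pderiv_at i (\<lambda>x. complex_of_real (l x)) = (\<lambda>x. complex_of_real (l (axis i 1)))" for i
      using pderiv_at_eq[OF d] by blast
    then show ?thesis using d by (auto simp: Suc differentiable_def differentiable_upto_const)
  qed
  then show ?thesis by (simp add: smooth_iff_differentiable_upto)
qed

lemma smooth_of_real_polynomial_function:
  "real_polynomial_function p \<Longrightarrow> smooth (\<lambda>x. complex_of_real (p x))"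
  by (induction p rule: real_polynomial_function.induct)
     (auto intro: smooth_of_real_bounded_linear smooth_const smooth_add smooth_mult)

text \<open>The family \<open>p(1/t) e\<^sup>-\<^sup>1\<^sup>/\<^sup>t\<close> (for \<open>t > 0\<close>) is closed under differentiation.\<close>

definition flat_exp :: "real poly \<Rightarrow> real \<Rightarrow> real" where
  "flat_exp p t = (if t > 0 then poly p (1 / t) * exp (- (1 / t)) else 0)"

lemma poly_mult_exp_minus_tendsto_0:
  fixes p :: "real poly"
  shows "((\<lambda>u. poly p u * exp (- u)) \<longlongrightarrow> 0) at_top"
proof -
  have "((\<lambda>u. \<Sum>i\<le>degree p. coeff p i * (u ^ i / exp u)) \<longlongrightarrow> (\<Sum>i\<le>degree p. coeff p i * 0)) at_top"
    by (intro tendsto_sum tendsto_mult tendsto_const tendsto_power_div_exp_0)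
  then show ?thesis
    by (simp add: poly_altdef sum_distrib_right exp_minus divide_inverse mult.assoc)
qed

text \<open>With u = 1/t one has du/dt = -u^2, so p(u) e^(-u) has derivative u^2 (p - p')(u) e^(-u);
  the factor \<open>[:0, 0, 1:]\<close> is u^2. At 0 the right difference quotient is u p(u) e^(-u),
  which tends to 0 as u grows.\<close>

lemma flat_exp_derivative:
  "(flat_exp p has_real_derivative flat_exp ([:0, 0, 1:] * (p - pderiv p)) t) (at t)"
proof -
  consider "t > 0" | "t < 0" | "t = 0" by linarith
  then show ?thesis
  proof cases
    case 1
    have "((\<lambda>t. poly p (1 / t) * exp (- (1 / t))) has_real_derivative
        flat_exp ([:0, 0, 1:] * (p - pderiv p)) t) (at t)"
      using 1 by (auto intro!: derivative_eq_intros poly_DERIV[THEN DERIV_chain2]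
         simp: flat_exp_def field_simps power2_eq_square)
    then show ?thesis
      by (rule has_field_derivative_transform_within_open[where S="{0<..}"])
         (use 1 in \<open>auto simp: flat_exp_def\<close>)
  next
    case 2
    have "((\<lambda>t. 0) has_real_derivative flat_exp ([:0, 0, 1:] * (p - pderiv p)) t) (at t)"
      using 2 by (simp add: flat_exp_def)
    then show ?thesis
      by (rule has_field_derivative_transform_within_open[where S="{..<0}"])
         (use 2 in \<open>auto simp: flat_exp_def\<close>)
  next
    case 3
    have "((\<lambda>h. flat_exp p h / h) \<longlongrightarrow> 0) (at_right 0)"
    proof (rule Lim_transform_eventually)
      show "((\<lambda>h. poly (pCons 0 p) (inverse h) * exp (- inverse h)) \<longlongrightarrow> 0) (at_right 0)"
        by (rule filterlim_compose[OF poly_mult_exp_minus_tendsto_0 filterlim_inverse_at_top_right])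
      show "\<forall>\<^sub>F h in at_right 0. poly (pCons 0 p) (inverse h) * exp (- inverse h) = flat_exp p h / h"
        by (auto simp: eventually_at_filter flat_exp_def field_simps)
    qed
    moreover have "((\<lambda>h. flat_exp p h / h) \<longlongrightarrow> 0) (at_left 0)"
      by (rule Lim_transform_eventually[OF tendsto_const])
         (auto simp: eventually_at_filter flat_exp_def)
    ultimately have "((\<lambda>h. flat_exp p h / h) \<longlongrightarrow> 0) (at 0)"
      by (simp add: filterlim_at_split)
    then show ?thesis
      by (simp add: 3 DERIV_def flat_exp_def)
  qed
qed

text \<open>All polynomials are treated at once, since differentiation changes \<open>p\<close>. The
  affine argument covers both kinds of factor, growing and decreasing in a coordinate, of a bump
  function on a box.\<close>

lemma smooth_flat_exp: "smooth (\<lambda>x::real^'n::finite. complex_of_real (flat_exp p (c * x $ j + d)))"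
proof -
  have d: "((\<lambda>x::real^'n. complex_of_real (flat_exp p (c * x $ j + d))) has_derivative
      (\<lambda>h. complex_of_real (flat_exp ([:0, 0, 1:] * (p - pderiv p)) (c * x $ j + d) * (c * h $ j)))) (at x)"
    for p x
  proof -
    have "((\<lambda>x::real^'n. c * x $ j + d) has_derivative (\<lambda>h. c * h $ j)) (at x)"
      by (auto intro!: derivative_eq_intros bounded_linear_imp_has_derivative bounded_linear_vec_nth)
    from has_derivative_compose[OF this flat_exp_derivative[unfolded has_field_derivative_def]]
    show ?thesis by (intro has_derivative_of_real)
  qed
  have "differentiable_upto k (\<lambda>x::real^'n. complex_of_real (flat_exp p (c * x $ j + d)))" for k
  proof (induction k arbitrary: p)
    case 0 then show ?case using d by (auto simp: differentiable_def)
  next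
    case (Suc k)
    have "pderiv_at i (\<lambda>x::real^'n. complex_of_real (flat_exp p (c * x $ j + d))) =
       (\<lambda>x. complex_of_real (flat_exp ([:0, 0, 1:] * (p - pderiv p)) (c * x $ j + d)) *
            complex_of_real (c * axis i 1 $ j))" for i :: 'n
      using pderiv_at_eq[OF d[of p]] by force
    then show ?case
      using d[of p] Suc[of "[:0, 0, 1:] * (p - pderiv p)"]
      by (auto simp only: differentiable_upto.simps intro: differentiableI intro!: differentiable_upto_mult differentiable_upto_const)
  qed
  then show ?thesis by (simp add: smooth_iff_differentiable_upto)
qed

section \<open>The algebra of test functions\<close>

lemma test_functions_smooth: "\<phi> \<in> test_functions \<Omega> \<Longrightarrow> smooth \<phi>"
  by (simp add: test_functions_def)

lemma test_functionsI:
  assumes "smooth \<phi>" "compact K" "K \<subseteq> \<Omega>" "\<And>x. x \<notin> K \<Longrightarrow> \<phi> x = 0"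
  shows "\<phi> \<in> test_functions \<Omega>"
proof -
  have "closure {x. \<phi> x \<noteq> 0} \<subseteq> K"
    using assms(2,4) by (intro closure_minimal) (auto simp: compact_imp_closed)
  moreover from this have "compact (closure {x. \<phi> x \<noteq> 0})"
    using compact_Int_closed[OF assms(2) closed_closure[of "{x. \<phi> x \<noteq> 0}"]] by (simp only: Int_absorb1)
  ultimately show ?thesis using assms(1,3)
    by (auto simp: test_functions_def)
qed

lemma test_functionsE:
  assumes "\<phi> \<in> test_functions \<Omega>"
  obtains K where "smooth \<phi>" "compact K" "K \<subseteq> \<Omega>" "\<forall>x. x \<notin> K \<longrightarrow> \<phi> x = 0"
proof (rule that)
  show "smooth \<phi>" "compact (closure {x. \<phi> x \<noteq> 0})" "closure {x. \<phi> x \<noteq> 0} \<subseteq> \<Omega>"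
    using assms by (auto simp: test_functions_def)
  show "\<forall>x. x \<notin> closure {x. \<phi> x \<noteq> 0} \<longrightarrow> \<phi> x = 0"
    using closure_subset[of "{x. \<phi> x \<noteq> 0}"] by blast
qed

lemma test_functions_add:
  assumes "\<phi> \<in> test_functions \<Omega>" "\<psi> \<in> test_functions \<Omega>"
  shows "(\<lambda>x. \<phi> x + \<psi> x) \<in> test_functions \<Omega>"
proof -
  obtain K where "smooth \<phi>" "compact K" "K \<subseteq> \<Omega>" "\<forall>x. x \<notin> K \<longrightarrow> \<phi> x = 0"
    by (rule test_functionsE[OF assms(1)])
  moreover obtain L where "smooth \<psi>" "compact L" "L \<subseteq> \<Omega>" "\<forall>x. x \<notin> L \<longrightarrow> \<psi> x = 0"
    by (rule test_functionsE[OF assms(2)])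
  ultimately show ?thesis
    by (intro test_functionsI[of _ "K \<union> L"] smooth_add) auto
qed

lemma test_functions_mult:
  assumes "smooth m" "\<phi> \<in> test_functions \<Omega>"
  shows "(\<lambda>x. m x * \<phi> x) \<in> test_functions \<Omega>"
proof -
  obtain K where "smooth \<phi>" "compact K" "K \<subseteq> \<Omega>" "\<forall>x. x \<notin> K \<longrightarrow> \<phi> x = 0"
    by (rule test_functionsE[OF assms(2)])
  then show ?thesis
    by (intro test_functionsI[of _ K] smooth_mult assms) auto
qed

lemma test_functions_cmult: "\<phi> \<in> test_functions \<Omega> \<Longrightarrow> (\<lambda>x. c * \<phi> x) \<in> test_functions \<Omega>"
  by (rule test_functions_mult[OF smooth_const])

lemma test_functions_diff:
  "\<phi> \<in> test_functions \<Omega> \<Longrightarrow> \<psi> \<in> test_functions \<Omega> \<Longrightarrow> (\<lambda>x. \<phi> x - \<psi> x) \<in> test_functions \<Omega>"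
  using test_functions_add[of \<phi> \<Omega> "\<lambda>x. (-1) * \<psi> x"] test_functions_cmult[of \<psi> \<Omega> "-1"] by simp

lemma zero_test_function: "(\<lambda>x. 0) \<in> test_functions \<Omega>"
  by (rule test_functionsI[of _ "{}"]) (auto simp: smooth_const)

lemma pderiv_at_eq_0:
  assumes "closed K" "\<And>x. x \<notin> K \<Longrightarrow> \<phi> x = 0" "x \<notin> K"
  shows "pderiv_at i \<phi> x = 0"
proof -
  have "((\<lambda>x. 0) has_derivative (\<lambda>h. 0)) (at x)" by simp
  then have "(\<phi> has_derivative (\<lambda>h. 0)) (at x)"
    by (rule has_derivative_transform_within_open[where s="-K"]) (use assms in auto)
  then show ?thesis using pderiv_at_eq by blast
qed

lemma test_functions_pderiv_at:
  assumes "\<phi> \<in> test_functions \<Omega>"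
  shows "pderiv_at i \<phi> \<in> test_functions \<Omega>"
proof -
  obtain K where K: "smooth \<phi>" "compact K" "K \<subseteq> \<Omega>" "\<forall>x. x \<notin> K \<longrightarrow> \<phi> x = 0"
    by (rule test_functionsE[OF assms])
  show ?thesis
    by (rule test_functionsI[of _ K])
       (use K in \<open>auto simp: smooth_pderiv_at compact_imp_closed intro: pderiv_at_eq_0[of K]\<close>)
qed

lemma test_functions_bounded:
  assumes "\<phi> \<in> test_functions \<Omega>"
  obtains B where "\<And>x. cmod (\<phi> x) \<le> B" "B \<ge> 0"
proof -
  obtain K where K: "smooth \<phi>" "compact K" "K \<subseteq> \<Omega>" "\<forall>x. x \<notin> K \<longrightarrow> \<phi> x = 0"
    by (rule test_functionsE[OF assms])
  have "bounded (\<phi> ` K)"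
    by (intro compact_imp_bounded compact_continuous_image smooth_continuous_on K)
  then obtain B where B: "\<And>x. x \<in> K \<Longrightarrow> cmod (\<phi> x) \<le> B"
    unfolding bounded_iff by blast
  show ?thesis
    by (rule that[of "max B 0"]) (use B K(4) in \<open>fastforce simp: le_max_iff_disj\<close>)+
qed

lemma pderiv_at_diff:
  assumes "smooth f" "smooth g"
  shows "pderiv_at i (\<lambda>x. f x - g x) = (\<lambda>x. pderiv_at i f x - pderiv_at i g x)"
proof -
  have "pderiv_at i (\<lambda>x. f x + (-1) * g x) = (\<lambda>x. pderiv_at i f x + pderiv_at i (\<lambda>x. (-1) * g x) x)"
    using assms by (intro pderiv_at_add smooth_differentiable smooth_mult smooth_const)
  moreover have "pderiv_at i (\<lambda>x. (-1) * g x) = (\<lambda>x. (-1) * pderiv_at i g x + pderiv_at i (\<lambda>x. -1) x * g x)"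
    using assms by (intro pderiv_at_mult smooth_differentiable smooth_const)
  ultimately show ?thesis by simp
qed

lemma pderiv_at_cmult:
  assumes "smooth f"
  shows "pderiv_at i (\<lambda>x. c * f x) = (\<lambda>x. c * pderiv_at i f x)"
  using pderiv_at_mult[of "\<lambda>x. c" f i] assms smooth_const smooth_differentiable by force

section \<open>Integration by parts and the fundamental lemma\<close>

locale bounded_domain =
  fixes \<Omega> :: "(real ^ 'n::finite) set"
  assumes open_domain: "open \<Omega>" and bounded_domain: "bounded \<Omega>"
begin

lemma domain_sets [simp]: "\<Omega> \<in> sets lebesgue"
  using open_domain by simp

lemma finite_measure_domain: "finite_measure (lebesgue_on \<Omega>)"
proof
  have "\<Omega> \<in> lmeasurable"
    using bounded_domain by (simp add: bounded_set_imp_lmeasurable)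
  then show "emeasure (lebesgue_on \<Omega>) (space (lebesgue_on \<Omega>)) \<noteq> \<infinity>"
    by (simp add: emeasure_restrict_space fmeasurable_def)
qed

lemma measurable_smooth: "smooth f \<Longrightarrow> f \<in> borel_measurable (lebesgue_on \<Omega>)"
  by (simp add: continuous_imp_measurable_on_sets_lebesgue smooth_continuous_on)

lemma sets_Int_domain: "A \<in> sets lebesgue \<Longrightarrow> {x \<in> \<Omega>. x \<in> A} \<in> sets (lebesgue_on \<Omega>)"
  by (auto simp: sets_restrict_space_iff Collect_conj_eq)

lemma one_in_L2: "(\<lambda>x. 1) \<in> L2 \<Omega>"
proof -
  interpret finite_measure "lebesgue_on \<Omega>" by (rule finite_measure_domain)
  show ?thesis by (simp add: L2_def)
qed

lemma test_functions_L2: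
  assumes "\<phi> \<in> test_functions \<Omega>"
  shows "\<phi> \<in> L2 \<Omega>"
proof -
  obtain B where "\<And>x. cmod (\<phi> x) \<le> B" by (rule test_functions_bounded[OF assms]) blast
  from L2_mult_bounded[OF one_in_L2 measurable_smooth[OF test_functions_smooth[OF assms]] this]
  show ?thesis by simp
qed

lemma pderiv_at_L2: "\<phi> \<in> test_functions \<Omega> \<Longrightarrow> pderiv_at i \<phi> \<in> L2 \<Omega>"
  by (intro test_functions_L2 test_functions_pderiv_at)

text \<open>By translation invariance the difference quotients of \<open>\<phi>\<close> have integral zero.\<close>

lemma integral_pderiv_at_test_function:
  assumes "\<phi> \<in> test_functions \<Omega>"
  shows "(\<integral>x. pderiv_at i \<phi> x \<partial>(lebesgue_on \<Omega>)) = 0"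
proof -
  obtain K where K: "smooth \<phi>" "compact K" "K \<subseteq> \<Omega>" "\<forall>x. x \<notin> K \<longrightarrow> \<phi> x = 0"
    by (rule test_functionsE[OF assms])
  obtain B where B: "\<And>x. cmod (pderiv_at i \<phi> x) \<le> B" "B \<ge> 0"
    by (rule test_functions_bounded[OF test_functions_pderiv_at[OF assms, of i]]) blast
  obtain R where R: "K \<subseteq> cball 0 R"
    using compact_imp_bounded[OF K(2)] bounded_subset_ballD ball_subset_cball by (metis subset_trans)
  have [measurable]: "\<phi> \<in> borel_measurable borel" "pderiv_at i \<phi> \<in> borel_measurable borel"
    using K(1) by (auto intro!: borel_measurable_continuous_onI smooth_continuous_on smooth_pderiv_at)
  have int: "integrable lborel \<phi>"
  proof -
    have "integrable lborel (\<lambda>x. indicator K x *\<^sub>R \<phi> x)"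
      by (intro borel_integrable_compact K smooth_continuous_on)
    moreover have "(\<lambda>x. indicator K x *\<^sub>R \<phi> x) = \<phi>"
      using K(4) by (auto simp: indicator_def)
    ultimately show ?thesis by simp
  qed
  define h where "h n = axis i (1 / real (Suc n))" for n
  have h_eq: "h n = (1 / real (Suc n)) *\<^sub>R axis i 1" for n
    by (simp add: h_def vec_eq_iff axis_def)
  have norm_h: "norm (h n) = 1 / real (Suc n)" for n
    by (simp add: h_eq norm_axis_1)
  define D where "D n x = real (Suc n) *\<^sub>R (\<phi> (h n + x) - \<phi> x)" for n x
  have [measurable]: "D n \<in> borel_measurable borel" for n
    unfolding D_def by measurable
  have D0: "(\<integral>x. D n x \<partial>lborel) = 0" for n
  proof -
    have 1: "integrable lborel (\<lambda>x. \<phi> (h n + x))"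
      using int by (subst integrable_distr_eq[where g="(+) (h n)" and N=borel, symmetric])
         (simp_all add: lborel_distr_plus)
    have 2: "(\<integral>x. \<phi> (h n + x) \<partial>lborel) = (\<integral>x. \<phi> x \<partial>lborel)"
      by (subst integral_distr[where g="(+) (h n)" and N=borel, symmetric])
         (simp_all add: lborel_distr_plus)
    show ?thesis
      unfolding D_def using 1 2 int by simp
  qed
  have D_lim: "(\<lambda>n. D n x) \<longlonglongrightarrow> pderiv_at i \<phi> x" for x
  proof -
    let ?L = "frechet_derivative \<phi> (at x)"
    have "(\<phi> has_derivative ?L) (at x)" using K(1) by (rule smooth_has_derivative)
    then have L: "bounded_linear ?L"
      and lim: "((\<lambda>h. norm (\<phi> (x + h) - \<phi> x - ?L h) / norm h) \<longlongrightarrow> 0) (at 0)"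
      by (auto simp: has_derivative_at)
    have "filterlim h (at 0) sequentially"
    proof (rule filterlim_atI)
      show "h \<longlonglongrightarrow> 0"
        by (rule tendsto_norm_zero_cancel) (use LIMSEQ_inverse_real_of_nat in \<open>simp add: norm_h inverse_eq_divide\<close>)
      show "\<forall>\<^sub>F n in sequentially. h n \<noteq> 0"
        using norm_h by (intro always_eventually allI notI) (metis norm_zero of_nat_neq_0 divide_eq_0_iff zero_neq_one)
    qed
    from filterlim_compose[OF lim this]
    have "(\<lambda>n. norm (\<phi> (x + h n) - \<phi> x - ?L (h n)) / norm (h n)) \<longlonglongrightarrow> 0" .
    moreover have "norm (\<phi> (x + h n) - \<phi> x - ?L (h n)) / norm (h n) = norm (D n x - pderiv_at i \<phi> x)" for n
    proof -
      have "D n x - pderiv_at i \<phi> x = real (Suc n) *\<^sub>R (\<phi> (x + h n) - \<phi> x - ?L (h n))"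
        using linear_scale[OF bounded_linear.linear[OF L]]
        by (simp add: D_def pderiv_at_def h_eq add.commute scaleR_diff_right del: of_nat_Suc)
      then show ?thesis by (simp add: norm_h del: of_nat_Suc)
    qed
    ultimately have "(\<lambda>n. D n x - pderiv_at i \<phi> x) \<longlonglongrightarrow> 0"
      by (simp add: tendsto_norm_zero_iff)
    then show ?thesis by (simp add: LIM_zero_iff)
  qed
  \<comment> \<open>The mean value theorem along direction \<open>i\<close> bounds the quotient by
    \<open>B\<close>. Since \<open>h n\<close> has length at most 1, the quotient vanishes outside
    the ball of radius \<open>R + 1\<close>.\<close>
  have D_bound: "norm (D n x) \<le> B * indicator (cball 0 (R + 1)) x" for n x
  proof (cases "x \<in> cball 0 (R + 1)")
    case True
    define t where "t = 1 / real (Suc n)"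
    have "norm (\<phi> (x + t *\<^sub>R axis i 1) - \<phi> (x + 0 *\<^sub>R axis i 1)) \<le> B * norm (t - 0)"
    proof (rule differentiable_bound[where S=UNIV and f="\<lambda>s. \<phi> (x + s *\<^sub>R axis i 1)"
          and f'="\<lambda>s r. r *\<^sub>R pderiv_at i \<phi> (x + s *\<^sub>R axis i 1)"])
      fix s :: real
      let ?L = "frechet_derivative \<phi> (at (x + s *\<^sub>R axis i 1))"
      have L: "(\<phi> has_derivative ?L) (at (x + s *\<^sub>R axis i 1))" using K(1) by (rule smooth_has_derivative)
      have "((\<lambda>s. x + s *\<^sub>R axis i 1) has_derivative (\<lambda>r. r *\<^sub>R axis i 1)) (at s)"
        by (auto intro!: derivative_eq_intros)
      from has_derivative_compose[OF this L]
      have "((\<lambda>s. \<phi> (x + s *\<^sub>R axis i 1)) has_derivative (\<lambda>r. ?L (r *\<^sub>R axis i 1))) (at s)" .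
      also have "(\<lambda>r. ?L (r *\<^sub>R axis i 1)) = (\<lambda>r. r *\<^sub>R pderiv_at i \<phi> (x + s *\<^sub>R axis i 1))"
        by (simp add: pderiv_at_def linear_scale[OF has_derivative_linear[OF L]])
      finally show "((\<lambda>s. \<phi> (x + s *\<^sub>R axis i 1)) has_derivative (\<lambda>r. r *\<^sub>R pderiv_at i \<phi> (x + s *\<^sub>R axis i 1))) (at s within UNIV)"
        by simp
      show "onorm (\<lambda>r. r *\<^sub>R pderiv_at i \<phi> (x + s *\<^sub>R axis i 1)) \<le> B"
        by (rule onorm_le) (simp add: B(1) mult.commute[of B] mult_left_mono)
    qed auto
    moreover have "D n x = real (Suc n) *\<^sub>R (\<phi> (x + t *\<^sub>R axis i 1) - \<phi> (x + 0 *\<^sub>R axis i 1))"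
      by (simp add: D_def h_eq t_def add.commute)
    ultimately have "norm (D n x) \<le> real (Suc n) * (B * norm (t - 0))"
      by (metis abs_of_nat mult_left_mono norm_scaleR of_nat_0_le_iff)
    then show ?thesis using True by (simp add: t_def del: of_nat_Suc)
  next
    case False
    have "norm (h n) \<le> 1" by (simp add: norm_h)
    then have "norm (h n + x) > R"
      using False norm_triangle_ineq4[of "h n + x" "h n"] by simp
    then have "h n + x \<notin> K" "x \<notin> K" using R False by auto
    then show ?thesis using K(4) B(2) by (simp add: D_def)
  qed
  have "(\<lambda>n. \<integral>x. D n x \<partial>lborel) \<longlonglongrightarrow> (\<integral>x. pderiv_at i \<phi> x \<partial>lborel)"
  proof (rule integral_dominated_convergence)
    show "integrable lborel (\<lambda>x. B * indicator (cball 0 (R + 1)) x)"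
      by (intro integrable_mult_right integrable_real_indicator) (use emeasure_lborel_cball_finite in auto)
  qed (use D_lim D_bound in auto)
  then have 0: "(\<integral>x. pderiv_at i \<phi> x \<partial>lborel) = 0"
    by (simp add: D0 LIMSEQ_const_iff)
  \<comment> \<open>The derivative vanishes off \<open>K\<close>, which lies in \<Omega>, so cutting
    it off outside \<Omega> changes nothing.\<close>
  have "(\<integral>x. pderiv_at i \<phi> x \<partial>(lebesgue_on \<Omega>)) = (\<integral>x. (if x \<in> \<Omega> then pderiv_at i \<phi> x else 0) \<partial>lebesgue)"
    by (rule Lebesgue_Measure.integral_restrict_UNIV[symmetric]) simp
  also have "(\<lambda>x. if x \<in> \<Omega> then pderiv_at i \<phi> x else 0) = pderiv_at i \<phi>"
    using pderiv_at_eq_0[of K \<phi> _ i] K by (auto simp: compact_imp_closed fun_eq_iff)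
  also have "(\<integral>x. pderiv_at i \<phi> x \<partial>lebesgue) = (\<integral>x. pderiv_at i \<phi> x \<partial>lborel)"
    by (rule integral_completion) simp
  finally show ?thesis using 0 by simp
qed

text \<open>Integration by parts: the product of two test functions is a test function, and the
  integral of its derivative is zero.\<close>

lemma has_weak_pderiv_test_function:
  assumes "\<phi> \<in> test_functions \<Omega>"
  shows "has_weak_pderiv \<Omega> i \<phi> (pderiv_at i \<phi>)"
  unfolding has_weak_pderiv_def
proof
  fix \<psi> assume \<psi>: "\<psi> \<in> test_functions \<Omega>"
  note sm = assms[THEN test_functions_smooth] \<psi>[THEN test_functions_smooth]
  have "0 = (\<integral>x. \<phi> x * pderiv_at i \<psi> x + pderiv_at i \<phi> x * \<psi> x \<partial>(lebesgue_on \<Omega>))"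
    using integral_pderiv_at_test_function[OF test_functions_mult[OF sm(1) \<psi>], of i]
      pderiv_at_mult[OF sm[THEN smooth_differentiable]] by simp
  also have "\<dots> = (\<integral>x. \<phi> x * pderiv_at i \<psi> x \<partial>(lebesgue_on \<Omega>)) + (\<integral>x. pderiv_at i \<phi> x * \<psi> x \<partial>(lebesgue_on \<Omega>))"
    using assms \<psi> by (intro Bochner_Integration.integral_add L2_integrable_mult test_functions_L2 pderiv_at_L2)
  finally show "(\<integral>x. \<phi> x * pderiv_at i \<psi> x \<partial>(lebesgue_on \<Omega>)) = - (\<integral>x. pderiv_at i \<phi> x * \<psi> x \<partial>(lebesgue_on \<Omega>))"
    by (simp add: eq_neg_iff_add_eq_0)
qed

text \<open>The indicator of an open box is the pointwise limit of bumps with values in [0, 1],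
  products over the coordinates of exp(-1/(n (x_i - c_i))) exp(-1/(n (d_i - x_i))). Their supports
  lie in the closed box, which is why that box must lie in \<Omega>.\<close>

lemma integral_box_eq_0:
  assumes g: "g \<in> L2 \<Omega>" and 0: "\<And>\<phi>. \<phi> \<in> test_functions \<Omega> \<Longrightarrow> (\<integral>x. g x * \<phi> x \<partial>(lebesgue_on \<Omega>)) = 0"
    and sub: "cbox c d \<subseteq> \<Omega>"
  shows "(\<integral>x. indicator (box c d) x *\<^sub>R g x \<partial>(lebesgue_on \<Omega>)) = 0"
proof -
  define \<phi> :: "nat \<Rightarrow> real^'n \<Rightarrow> complex" where "\<phi> n x =
     (\<Prod>i\<in>UNIV. complex_of_real (flat_exp 1 (real n * x $ i + (- real n * c $ i))) *
               complex_of_real (flat_exp 1 ((- real n) * x $ i + real n * d $ i)))" for n x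
  have flat: "0 \<le> flat_exp 1 t" "flat_exp 1 t \<le> 1" for t by (auto simp: flat_exp_def)
  have out: "\<phi> n x = 0" if "x \<notin> box c d" for n x
  proof -
    obtain i where "x $ i \<le> c $ i \<or> d $ i \<le> x $ i"
      using \<open>x \<notin> box c d\<close> by (auto simp: mem_box_cart not_less)
    then have "real n * x $ i + (- real n * c $ i) \<le> 0 \<or> (- real n) * x $ i + real n * d $ i \<le> 0"
      by (auto simp: mult_left_mono)
    then show ?thesis
      unfolding \<phi>_def by (intro prod_zero bexI[of _ i]) (auto simp: flat_exp_def)
  qed
  have test: "\<phi> n \<in> test_functions \<Omega>" for n
  proof (rule test_functionsI)
    show "smooth (\<phi> n)"
      unfolding \<phi>_def by (intro smooth_prod smooth_mult smooth_flat_exp) simp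
    show "\<phi> n x = 0" if "x \<notin> cbox c d" for x
      using that out box_subset_cbox by blast
  qed (use sub in auto)
  have one: "(\<lambda>n. complex_of_real (flat_exp 1 (real n * s))) \<longlonglongrightarrow> 1" if "s > 0" for s
  proof -
    have "(\<lambda>n. exp (- (inverse s * (1 / real n)))) \<longlonglongrightarrow> exp (- (inverse s * 0))"
      by (intro tendsto_intros lim_1_over_n)
    moreover have "\<forall>\<^sub>F n in sequentially. exp (- (inverse s * (1 / real n))) = flat_exp 1 (real n * s)"
      using eventually_gt_at_top[of 0] by eventually_elim (use \<open>s > 0\<close> in \<open>simp add: flat_exp_def field_simps\<close>)
    ultimately have "(\<lambda>n. flat_exp 1 (real n * s)) \<longlonglongrightarrow> 1"
      by (auto intro: Lim_transform_eventually)
    then show ?thesis by (metis of_real_1 tendsto_of_real)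
  qed
  have lim: "(\<lambda>n. \<phi> n x) \<longlonglongrightarrow> indicator (box c d) x" for x
  proof (cases "x \<in> box c d")
    case True
    have "(\<lambda>n. complex_of_real (flat_exp 1 (real n * (x $ i - c $ i))) *
             complex_of_real (flat_exp 1 (real n * (d $ i - x $ i)))) \<longlonglongrightarrow> 1 * 1" for i
      using True by (intro tendsto_mult one) (auto simp: mem_box_cart)
    then have "(\<lambda>n. \<Prod>i\<in>UNIV. complex_of_real (flat_exp 1 (real n * (x $ i - c $ i))) *
             complex_of_real (flat_exp 1 (real n * (d $ i - x $ i)))) \<longlonglongrightarrow> (\<Prod>i\<in>(UNIV::'n set). 1 * 1)"
      by (intro tendsto_prod)
    then show ?thesis using True by (simp add: \<phi>_def algebra_simps)
  qed (simp add: out)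
  have "(\<lambda>n. \<integral>x. g x * \<phi> n x \<partial>(lebesgue_on \<Omega>)) \<longlonglongrightarrow> (\<integral>x. indicator (box c d) x *\<^sub>R g x \<partial>(lebesgue_on \<Omega>))"
  proof (rule integral_dominated_convergence)
    note [measurable] = L2_measurable[OF g] measurable_smooth[OF test_functions_smooth[OF test]]
    show "(\<lambda>x. indicator (box c d) x *\<^sub>R g x) \<in> borel_measurable (lebesgue_on \<Omega>)"
      using sets_Int_domain[of "box c d"] L2_measurable[OF g]
      by (intro borel_measurable_scaleR borel_measurable_indicator') auto
    show "(\<lambda>x. g x * \<phi> n x) \<in> borel_measurable (lebesgue_on \<Omega>)" for n by measurable
    show "integrable (lebesgue_on \<Omega>) (\<lambda>x. cmod (g x))"
      using L2_integrable_norm_mult[OF g one_in_L2] by simp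
    have "(\<lambda>n. g x * \<phi> n x) \<longlonglongrightarrow> g x * indicator (box c d) x" for x
      by (intro tendsto_intros lim)
    moreover have "g x * indicator (box c d) x = indicator (box c d) x *\<^sub>R g x" for x
      by (simp add: indicator_def)
    ultimately show "AE x in lebesgue_on \<Omega>. (\<lambda>n. g x * \<phi> n x) \<longlonglongrightarrow> indicator (box c d) x *\<^sub>R g x" by simp
    have "cmod (\<phi> n x) \<le> 1" for n x
      unfolding \<phi>_def using flat
      by (auto simp: norm_mult simp flip: prod_norm intro!: prod_le_1 mult_le_one)
    then show "AE x in lebesgue_on \<Omega>. norm (g x * \<phi> n x) \<le> cmod (g x)" for n
      by (simp add: norm_mult mult_left_le)
  qed
  then show ?thesis by (simp add: 0[OF test] LIMSEQ_const_iff)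
qed

text \<open>Dynkin's theorem extends the vanishing of integrals from boxes to Borel sets.\<close>

lemma integral_borel_eq_0:
  assumes g: "g \<in> L2 \<Omega>" and 0: "\<And>\<phi>. \<phi> \<in> test_functions \<Omega> \<Longrightarrow> (\<integral>x. g x * \<phi> x \<partial>(lebesgue_on \<Omega>)) = 0"
    and sub: "cbox a b \<subseteq> \<Omega>" and A: "A \<in> sets borel"
  shows "(\<integral>x. indicator (A \<inter> box a b) x *\<^sub>R g x \<partial>(lebesgue_on \<Omega>)) = 0"
proof -
  let ?M = "lebesgue_on \<Omega>" let ?B = "box a b"
  have ig: "integrable ?M g" using L2_integrable_mult[OF g one_in_L2] by simp
  have lebes: "A \<inter> ?B \<in> sets lebesgue" if "A \<in> sets borel" for A :: "(real^'n) set"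
    using that by simp
  have int: "integrable ?M (\<lambda>x. indicator (A \<inter> ?B) x *\<^sub>R g x)" if "A \<in> sets borel" for A
  proof (rule Bochner_Integration.integrable_bound[OF ig])
    show "(\<lambda>x. indicator (A \<inter> ?B) x *\<^sub>R g x) \<in> borel_measurable ?M"
      using sets_Int_domain[OF lebes[OF that]] L2_measurable[OF g]
      by (intro borel_measurable_scaleR borel_measurable_indicator') auto
  qed (simp add: indicator_def)
  have sets: "sets borel = sigma_sets UNIV (range (\<lambda>(c, d). box c d :: (real^'n) set))"
    using borel_eq_box by (metis UNIV_I sets_measure_of subset_UNIV Pow_UNIV)
  have "Int_stable (range (\<lambda>(c, d). box c d :: (real^'n) set))"
    by (auto simp: Int_stable_def box_Int_box)
  moreover have "range (\<lambda>(c, d). box c d :: (real^'n) set) \<subseteq> Pow UNIV" by simp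
  moreover have "A \<in> sigma_sets UNIV (range (\<lambda>(c, d). box c d :: (real^'n) set))" using A sets by simp
  ultimately show ?thesis
  proof (induction rule: sigma_sets_induct_disjoint)
    fix X assume "X \<in> range (\<lambda>(c, d). box c d :: (real^'n) set)"
    then obtain c d where "X \<inter> ?B = box c d" by (auto simp: box_Int_box)
    show "(\<integral>x. indicator (X \<inter> ?B) x *\<^sub>R g x \<partial>?M) = 0"
    proof (cases "box c d = {}")
      case False
      \<comment> \<open>A nonempty open box has the closed box as its closure, so taking closures
        carries the inclusion over.\<close>
      then have "cbox c d \<subseteq> cbox a b"
        using \<open>X \<inter> ?B = box c d\<close> by (metis closure_box closure_mono empty_subsetI inf.cobounded2 subset_empty)
      then show ?thesis using integral_box_eq_0[OF g 0] sub \<open>X \<inter> ?B = box c d\<close> by auto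
    qed (use \<open>X \<inter> ?B = box c d\<close> in simp)
  next
    fix X assume X: "X \<in> sigma_sets UNIV (range (\<lambda>(c, d). box c d :: (real^'n) set))"
      and IH: "(\<integral>x. indicator (X \<inter> ?B) x *\<^sub>R g x \<partial>?M) = 0"
    have X: "X \<in> sets borel" using X sets by simp
    \<comment> \<open>Complements are taken inside \<open>box a b\<close>, whose own integral is
      already known to vanish.\<close>
    have "(\<integral>x. indicator ((UNIV - X) \<inter> ?B) x *\<^sub>R g x \<partial>?M) =
       (\<integral>x. indicator (UNIV \<inter> ?B) x *\<^sub>R g x - indicator (X \<inter> ?B) x *\<^sub>R g x \<partial>?M)"
      by (intro Bochner_Integration.integral_cong) (auto simp: indicator_def)
    also have "\<dots> = 0"
      using int[OF X] int[of UNIV] IH integral_box_eq_0[OF g 0 sub] by simp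
    finally show "(\<integral>x. indicator ((UNIV - X) \<inter> ?B) x *\<^sub>R g x \<partial>?M) = 0" .
  next
    fix X :: "nat \<Rightarrow> (real^'n) set"
    assume disj: "disjoint_family X" and X: "range X \<subseteq> sigma_sets UNIV (range (\<lambda>(c, d). box c d :: (real^'n) set))"
      and IH: "\<And>i. (\<integral>x. indicator (X i \<inter> ?B) x *\<^sub>R g x \<partial>?M) = 0"
    have X: "X i \<in> sets borel" for i using X sets by auto
    \<comment> \<open>Dominated convergence with majorant |g| reduces the countable union to finite
      disjoint ones, where the indicator is a finite sum.\<close>
    have "(\<lambda>n. \<integral>x. indicator ((\<Union>i<n. X i) \<inter> ?B) x *\<^sub>R g x \<partial>?M) \<longlonglongrightarrow>
       (\<integral>x. indicator ((\<Union>i. X i) \<inter> ?B) x *\<^sub>R g x \<partial>?M)"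
    proof (rule integral_dominated_convergence[where w="\<lambda>x. cmod (g x)"])
      show "AE x in ?M. (\<lambda>n. indicator ((\<Union>i<n. X i) \<inter> ?B) x *\<^sub>R g x) \<longlonglongrightarrow> indicator ((\<Union>i. X i) \<inter> ?B) x *\<^sub>R g x"
        unfolding indicator_inter_arith using LIMSEQ_indicator_UN[of X]
        by (intro AE_I2 tendsto_intros) auto
      show "(\<lambda>x. indicator ((\<Union>i. X i) \<inter> ?B) x *\<^sub>R g x) \<in> borel_measurable ?M"
        using X by (intro borel_measurable_integrable int) auto
      show "(\<lambda>x. indicator ((\<Union>i<n. X i) \<inter> ?B) x *\<^sub>R g x) \<in> borel_measurable ?M" for n
        using X by (intro borel_measurable_integrable int) auto
    qed (use ig in \<open>auto simp: indicator_def\<close>)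
    moreover have "(\<integral>x. indicator ((\<Union>i<n. X i) \<inter> ?B) x *\<^sub>R g x \<partial>?M) = 0" for n
    proof -
      have "indicator ((\<Union>i<n. X i) \<inter> ?B) x *\<^sub>R g x = (\<Sum>i<n. indicator (X i \<inter> ?B) x *\<^sub>R g x)" for x
      proof -
        have "indicat_real (\<Union>i<n. X i) x = (\<Sum>i<n. indicator (X i) x)"
          using disj by (intro indicator_UN_disjoint) (auto simp: disjoint_family_on_def)
        then show ?thesis
          by (simp add: indicator_inter_arith scaleR_sum_left[symmetric] flip: sum_distrib_right)
      qed
      then show ?thesis
        using Bochner_Integration.integral_sum[OF int[OF X], of "\<lambda>i. i" "{..<n}"]
        by (simp only: IH sum.neutral_const)
    qed
    ultimately show "(\<integral>x. indicator ((\<Union>i. X i) \<inter> ?B) x *\<^sub>R g x \<partial>?M) = 0"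
      by (simp add: LIMSEQ_const_iff)
  qed auto
qed

text \<open>The fundamental lemma of the calculus of variations. On a box inside \<Omega> the
  integrals of \<open>g\<close> over all measurable subsets vanish, which forces \<open>g\<close> to
  be null there; countably many such boxes cover \<Omega>.\<close>

lemma ae_eq_0I:
  assumes g: "g \<in> L2 \<Omega>" and 0: "\<And>\<phi>. \<phi> \<in> test_functions \<Omega> \<Longrightarrow> (\<integral>x. g x * \<phi> x \<partial>(lebesgue_on \<Omega>)) = 0"
  shows "ae_eq \<Omega> g (\<lambda>x. 0)"
proof -
  let ?M = "lebesgue_on \<Omega>"
  interpret finite_measure ?M by (rule finite_measure_domain)
  have ig: "integrable ?M g" using L2_integrable_mult[OF g one_in_L2] by simp
  have box: "AE x in ?M. x \<in> cbox a b \<longrightarrow> g x = 0" if sub: "cbox a b \<subseteq> \<Omega>" for a b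
  proof -
    let ?B = "box a b"
    have meas: "(\<lambda>x. indicator A x *\<^sub>R g x) \<in> borel_measurable ?M" if "A \<in> sets lebesgue" for A
      using sets_Int_domain[OF that] L2_measurable[OF g]
      by (intro borel_measurable_scaleR borel_measurable_indicator') auto
    have "AE x in ?M. indicator ?B x *\<^sub>R g x = 0"
    proof (rule density_zero)
      show "integrable ?M (\<lambda>x. indicator ?B x *\<^sub>R g x)"
        by (rule Bochner_Integration.integrable_bound[OF ig meas]) (auto simp: indicator_def)
      fix A assume "A \<in> sets ?M"
      then have A: "A \<in> sets lebesgue" by (simp add: sets_restrict_space_iff)
      \<comment> \<open>The Dynkin argument reaches only Borel sets; a Lebesgue set differs from its
        Borel part \<open>S\<close> by a null set.\<close>
      then obtain S N N' where SN: "A = S \<union> N" "N \<subseteq> N'" "N' \<in> null_sets lborel" "S \<in> sets lborel"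
        by (rule sets_completionE)
      have "AE x in lebesgue. x \<notin> N'"
        using SN(3) by (intro AE_completion AE_not_in)
      then have "AE x in ?M. x \<notin> N'"
        by (auto simp: AE_restrict_space_iff elim: AE_mp)
      then have "AE x in ?M. indicator (A \<inter> ?B) x *\<^sub>R g x = indicator (S \<inter> ?B) x *\<^sub>R g x"
        by eventually_elim (use SN in \<open>auto simp: indicator_def\<close>)
      moreover have "A \<inter> ?B \<in> sets lebesgue" "S \<inter> ?B \<in> sets lebesgue" using A SN(4) by auto
      ultimately have "(\<integral>x. indicator (A \<inter> ?B) x *\<^sub>R g x \<partial>?M) = (\<integral>x. indicator (S \<inter> ?B) x *\<^sub>R g x \<partial>?M)"
        by (intro integral_cong_AE meas)
      also have "\<dots> = 0" using integral_borel_eq_0[OF g 0 sub] SN(4) by simp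
      finally show "(LINT x:A|?M. indicator ?B x *\<^sub>R g x) = 0"
        by (simp add: set_lebesgue_integral_def indicator_inter_arith)
    qed
    \<comment> \<open>The cover of \<Omega> consists of closed boxes, while the argument so far
      treats open ones; the faces are null.\<close>
    moreover have "AE x in ?M. x \<notin> cbox a b - box a b"
      using AE_not_in[OF negligible_frontier_interval[of a b, unfolded negligible_iff_null_sets]]
      by (auto simp: AE_restrict_space_iff elim: AE_mp)
    ultimately show ?thesis by eventually_elim (auto simp: indicator_def)
  qed
  obtain D where D: "countable D" "D \<subseteq> Pow \<Omega>" "\<And>X. X \<in> D \<Longrightarrow> \<exists>a b. X = cbox a b" "\<Union>D = \<Omega>"
    using open_countable_Union_open_cbox[OF open_domain] by metis
  have "AE x in ?M. \<forall>X\<in>D. x \<in> X \<longrightarrow> g x = 0"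
    unfolding AE_ball_countable[OF D(1)] using D(2,3) box by blast
  moreover have "AE x in ?M. x \<in> \<Omega>" by (rule AE_I2) simp
  ultimately have "AE x in ?M. g x = 0" by eventually_elim (use D(4) in auto)
  then show ?thesis by (simp add: ae_eq_def)
qed

end

section \<open>The space \<open>W\<^sub>0\<^sup>1\<^sup>,\<^sup>2(\<Omega>)\<close>\<close>

context bounded_domain
begin

text \<open>Weak derivatives are defined by a bilinear pairing. Rewriting it as an inner product
  makes linearity and L^2 continuity available.\<close>

lemma integral_mult_test_function:
  "(\<integral>x. f x * \<phi> x \<partial>(lebesgue_on \<Omega>)) = l2_inner \<Omega> f (\<lambda>x. cnj (\<phi> x))"
  by (simp add: l2_inner_def)

lemma has_weak_pderiv_unique:
  assumes "g \<in> L2 \<Omega>" "g' \<in> L2 \<Omega>" "has_weak_pderiv \<Omega> i f g" "has_weak_pderiv \<Omega> i f g'"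
  shows "ae_eq \<Omega> g g'"
proof -
  have "ae_eq \<Omega> (\<lambda>x. g x - g' x) (\<lambda>x. 0)"
  proof (rule ae_eq_0I)
    show "(\<lambda>x. g x - g' x) \<in> L2 \<Omega>" using assms by (intro L2_diff)
    fix \<phi> assume "\<phi> \<in> test_functions \<Omega>"
    then show "(\<integral>x. (g x - g' x) * \<phi> x \<partial>(lebesgue_on \<Omega>)) = 0"
      using assms L2_cnj[OF test_functions_L2]
      by (simp add: integral_mult_test_function l2_inner_diff_left)
         (auto simp: has_weak_pderiv_def integral_mult_test_function)
  qed
  then show ?thesis by (simp add: ae_eq_def)
qed

lemma weak_pderiv_eq:
  assumes "g \<in> L2 \<Omega>" "has_weak_pderiv \<Omega> i f g"
  shows "weak_pderiv \<Omega> i f \<in> L2 \<Omega>" "has_weak_pderiv \<Omega> i f (weak_pderiv \<Omega> i f)" "ae_eq \<Omega> (weak_pderiv \<Omega> i f) g"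
proof -
  have *: "weak_pderiv \<Omega> i f \<in> L2 \<Omega> \<and> has_weak_pderiv \<Omega> i f (weak_pderiv \<Omega> i f)"
    unfolding weak_pderiv_def by (rule someI[of _ g]) (use assms in simp)
  then show "weak_pderiv \<Omega> i f \<in> L2 \<Omega>" "has_weak_pderiv \<Omega> i f (weak_pderiv \<Omega> i f)" by auto
  show "ae_eq \<Omega> (weak_pderiv \<Omega> i f) g"
    using has_weak_pderiv_unique * assms by blast
qed

lemma has_weak_pderiv_diff:
  assumes "f \<in> L2 \<Omega>" "f' \<in> L2 \<Omega>" "g \<in> L2 \<Omega>" "g' \<in> L2 \<Omega>"
    and "has_weak_pderiv \<Omega> i f g" "has_weak_pderiv \<Omega> i f' g'"
  shows "has_weak_pderiv \<Omega> i (\<lambda>x. f x - f' x) (\<lambda>x. g x - g' x)"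
  using assms L2_cnj[OF test_functions_L2] L2_cnj[OF pderiv_at_L2]
  unfolding has_weak_pderiv_def integral_mult_test_function
  by (simp add: l2_inner_diff_left)

text \<open>For a fixed test function both sides of the defining identity are continuous in L^2: the
  weak derivative is a closed operator.\<close>

lemma has_weak_pderiv_limit:
  assumes "\<And>n. f n \<in> L2 \<Omega>" "f' \<in> L2 \<Omega>" "\<And>n. g n \<in> L2 \<Omega>" "g' \<in> L2 \<Omega>"
    and "(\<lambda>n. l2_norm \<Omega> (\<lambda>x. f n x - f' x)) \<longlonglongrightarrow> 0" "(\<lambda>n. l2_norm \<Omega> (\<lambda>x. g n x - g' x)) \<longlonglongrightarrow> 0"
    and "\<And>n. has_weak_pderiv \<Omega> i (f n) (g n)"
  shows "has_weak_pderiv \<Omega> i f' g'"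
  unfolding has_weak_pderiv_def integral_mult_test_function
proof
  fix \<phi> assume \<phi>: "\<phi> \<in> test_functions \<Omega>"
  have "(\<lambda>n. l2_inner \<Omega> (f n) (\<lambda>x. cnj (pderiv_at i \<phi> x))) \<longlonglongrightarrow> l2_inner \<Omega> f' (\<lambda>x. cnj (pderiv_at i \<phi> x))"
    using assms L2_cnj[OF pderiv_at_L2[OF \<phi>]] by (intro l2_inner_tendsto)
  moreover have "(\<lambda>n. - l2_inner \<Omega> (g n) (\<lambda>x. cnj (\<phi> x))) \<longlonglongrightarrow> - l2_inner \<Omega> g' (\<lambda>x. cnj (\<phi> x))"
    using assms L2_cnj[OF test_functions_L2[OF \<phi>]] by (intro tendsto_minus l2_inner_tendsto)
  moreover have "l2_inner \<Omega> (f n) (\<lambda>x. cnj (pderiv_at i \<phi> x)) = - l2_inner \<Omega> (g n) (\<lambda>x. cnj (\<phi> x))" for n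
    using assms(7)[of n] \<phi> unfolding has_weak_pderiv_def integral_mult_test_function by blast
  ultimately show "l2_inner \<Omega> f' (\<lambda>x. cnj (pderiv_at i \<phi> x)) = - l2_inner \<Omega> g' (\<lambda>x. cnj (\<phi> x))"
    using LIMSEQ_unique by auto
qed

text \<open>\<open>dirichlet_gradient f g\<close> says that \<open>f \<in> W\<^sub>0\<^sup>1\<^sup>,\<^sup>2\<close> has gradient \<open>g\<close>; it avoids the choice made by
  \<^const>\<open>weak_pderiv\<close>.\<close>

definition dirichlet_gradient :: "'n fld \<Rightarrow> ('n \<Rightarrow> 'n fld) \<Rightarrow> bool" where
  "dirichlet_gradient f g \<longleftrightarrow> f \<in> L2 \<Omega> \<and> (\<forall>i. g i \<in> L2 \<Omega>) \<and>
     (\<exists>\<phi>::nat \<Rightarrow> 'n fld. (\<forall>k. \<phi> k \<in> test_functions \<Omega>)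
        \<and> (\<lambda>k. l2_norm \<Omega> (\<lambda>x. \<phi> k x - f x)) \<longlonglongrightarrow> 0
        \<and> (\<forall>i. (\<lambda>k. l2_norm \<Omega> (\<lambda>x. pderiv_at i (\<phi> k) x - g i x)) \<longlonglongrightarrow> 0))"

lemma dirichlet_gradient_L2:
  assumes "dirichlet_gradient f g"
  shows "f \<in> L2 \<Omega>" "g i \<in> L2 \<Omega>"
  using assms by (auto simp: dirichlet_gradient_def)

lemma dirichlet_gradient_has_weak_pderiv:
  assumes "dirichlet_gradient f g"
  shows "has_weak_pderiv \<Omega> i f (g i)"
proof -
  obtain \<phi> where \<phi>: "\<And>k. \<phi> k \<in> test_functions \<Omega>" "(\<lambda>k. l2_norm \<Omega> (\<lambda>x. \<phi> k x - f x)) \<longlonglongrightarrow> 0"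
    "\<And>i. (\<lambda>k. l2_norm \<Omega> (\<lambda>x. pderiv_at i (\<phi> k) x - g i x)) \<longlonglongrightarrow> 0"
    using assms by (auto simp: dirichlet_gradient_def)
  show ?thesis
    by (rule has_weak_pderiv_limit[of \<phi> f "\<lambda>k. pderiv_at i (\<phi> k)"])
       (use \<phi> assms in \<open>auto intro: test_functions_L2 pderiv_at_L2 has_weak_pderiv_test_function dirichlet_gradient_L2\<close>)
qed

lemma dirichlet_gradient_weak_pderiv:
  assumes "dirichlet_gradient f g"
  shows "ae_eq \<Omega> (weak_pderiv \<Omega> i f) (g i)" "weak_pderiv \<Omega> i f \<in> L2 \<Omega>"
  using weak_pderiv_eq dirichlet_gradient_has_weak_pderiv[OF assms] dirichlet_gradient_L2[OF assms]
  by blast+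

lemma dirichlet_gradient_W12:
  assumes "dirichlet_gradient f g"
  shows "f \<in> W12 \<Omega>"
  using dirichlet_gradient_has_weak_pderiv[OF assms] dirichlet_gradient_L2[OF assms]
  by (auto simp: W12_def)

text \<open>Replaces the chosen derivative inside \<open>w12_norm\<close> by a concrete function
  with the same norm; this links \<open>w12_norm\<close> to the componentwise limits in
  \<open>dirichlet_gradient\<close>.\<close>

lemma weak_pderiv_diff_test_function:
  assumes "f \<in> L2 \<Omega>" "g \<in> L2 \<Omega>" "has_weak_pderiv \<Omega> i f g" "\<phi> \<in> test_functions \<Omega>"
  shows "l2_norm \<Omega> (weak_pderiv \<Omega> i (\<lambda>x. f x - \<phi> x)) = l2_norm \<Omega> (\<lambda>x. pderiv_at i \<phi> x - g x)"
proof -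
  have L2: "(\<lambda>x. g x - pderiv_at i \<phi> x) \<in> L2 \<Omega>"
    using assms by (intro L2_diff pderiv_at_L2)
  have "has_weak_pderiv \<Omega> i (\<lambda>x. f x - \<phi> x) (\<lambda>x. g x - pderiv_at i \<phi> x)"
    using has_weak_pderiv_diff[OF assms(1) _ assms(2) _ assms(3) has_weak_pderiv_test_function]
      test_functions_L2[OF assms(4)] pderiv_at_L2[OF assms(4)] assms(4) by blast
  from weak_pderiv_eq[OF L2 this] show ?thesis
    using L2 l2_norm_cong l2_norm_minus_commute by metis
qed

lemma dirichlet_gradient_W12_0:
  assumes "dirichlet_gradient f g"
  shows "f \<in> W12_0 \<Omega>"
proof -
  obtain \<phi> where \<phi>: "\<And>k. \<phi> k \<in> test_functions \<Omega>" "(\<lambda>k. l2_norm \<Omega> (\<lambda>x. \<phi> k x - f x)) \<longlonglongrightarrow> 0"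
    "\<And>i. (\<lambda>k. l2_norm \<Omega> (\<lambda>x. pderiv_at i (\<phi> k) x - g i x)) \<longlonglongrightarrow> 0"
    using assms by (auto simp: dirichlet_gradient_def)
  have "w12_norm \<Omega> (\<lambda>x. f x - \<phi> k x) =
     sqrt ((l2_norm \<Omega> (\<lambda>x. \<phi> k x - f x))\<^sup>2 + (\<Sum>i\<in>UNIV. (l2_norm \<Omega> (\<lambda>x. pderiv_at i (\<phi> k) x - g i x))\<^sup>2))" for k
    unfolding w12_norm_def
    using weak_pderiv_diff_test_function[OF dirichlet_gradient_L2[OF assms] dirichlet_gradient_has_weak_pderiv[OF assms] \<phi>(1)[of k]]
      l2_norm_minus_commute[of \<Omega> f "\<phi> k"] by simp
  moreover have "(\<lambda>k. sqrt ((l2_norm \<Omega> (\<lambda>x. \<phi> k x - f x))\<^sup>2 + (\<Sum>i\<in>UNIV. (l2_norm \<Omega> (\<lambda>x. pderiv_at i (\<phi> k) x - g i x))\<^sup>2)))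
      \<longlonglongrightarrow> sqrt (0\<^sup>2 + (\<Sum>i\<in>(UNIV::'n set). 0\<^sup>2))"
    by (intro tendsto_intros \<phi>)
  ultimately have "(\<lambda>k. w12_norm \<Omega> (\<lambda>x. f x - \<phi> k x)) \<longlonglongrightarrow> 0" by simp
  then show ?thesis
    using \<phi>(1) dirichlet_gradient_W12[OF assms] by (auto simp: W12_0_def)
qed

text \<open>Any choice of weak derivatives serves as gradient: each component of the error is
  dominated by the \<open>w12_norm\<close> error of the given approximating sequence.\<close>

lemma W12_0_dirichlet_gradient:
  assumes "f \<in> W12_0 \<Omega>"
  obtains g where "dirichlet_gradient f g"
proof -
  obtain \<phi> where \<phi>: "\<And>k. \<phi> k \<in> test_functions \<Omega>" "(\<lambda>k. w12_norm \<Omega> (\<lambda>x. f x - \<phi> k x)) \<longlonglongrightarrow> 0"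
    using assms by (auto simp: W12_0_def)
  have f: "f \<in> L2 \<Omega>" using assms by (simp add: W12_0_def W12_def)
  have "\<forall>i. \<exists>g. g \<in> L2 \<Omega> \<and> has_weak_pderiv \<Omega> i f g" using assms by (auto simp: W12_0_def W12_def)
  then obtain g where g: "\<And>i. g i \<in> L2 \<Omega>" "\<And>i. has_weak_pderiv \<Omega> i f (g i)" by metis
  have 1: "l2_norm \<Omega> (\<lambda>x. \<phi> k x - f x) \<le> w12_norm \<Omega> (\<lambda>x. f x - \<phi> k x)" for k
    unfolding w12_norm_def by (subst l2_norm_minus_commute, rule real_le_rsqrt) (simp add: sum_nonneg)
  have 2: "l2_norm \<Omega> (\<lambda>x. pderiv_at i (\<phi> k) x - g i x) \<le> w12_norm \<Omega> (\<lambda>x. f x - \<phi> k x)" for i k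
    unfolding w12_norm_def weak_pderiv_diff_test_function[OF f g \<phi>(1)]
    by (rule real_le_rsqrt)
       (use member_le_sum[of i UNIV "\<lambda>i. (l2_norm \<Omega> (\<lambda>x. pderiv_at i (\<phi> k) x - g i x))\<^sup>2"]
         in \<open>auto intro: add_increasing\<close>)
  have "(\<lambda>k. l2_norm \<Omega> (\<lambda>x. \<phi> k x - f x)) \<longlonglongrightarrow> 0"
    by (rule tendsto_sandwich[OF _ _ tendsto_const \<phi>(2)]) (use 1 in auto)
  moreover have "(\<lambda>k. l2_norm \<Omega> (\<lambda>x. pderiv_at i (\<phi> k) x - g i x)) \<longlonglongrightarrow> 0" for i
    by (rule tendsto_sandwich[OF _ _ tendsto_const \<phi>(2)]) (use 2 in auto)
  ultimately show ?thesis
    using that[of g] f g \<phi>(1) by (auto simp: dirichlet_gradient_def)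
qed

lemma dirichlet_form_eq:
  assumes "dirichlet_gradient f g" "dirichlet_gradient u v"
  shows "dirichlet_form \<Omega> f u = (\<Sum>i\<in>UNIV. l2_inner \<Omega> (g i) (v i))"
  unfolding dirichlet_form_def
  using assms by (intro sum.cong l2_inner_cong dirichlet_gradient_weak_pderiv dirichlet_gradient_L2) auto

lemma dirichlet_gradient_diff:
  assumes "dirichlet_gradient f g" "dirichlet_gradient u v"
  shows "dirichlet_gradient (\<lambda>x. f x - u x) (\<lambda>i x. g i x - v i x)"
proof -
  note L2 = dirichlet_gradient_L2[OF assms(1)] dirichlet_gradient_L2[OF assms(2)]
  obtain \<phi> where \<phi>: "\<And>k. \<phi> k \<in> test_functions \<Omega>" "(\<lambda>k. l2_norm \<Omega> (\<lambda>x. \<phi> k x - f x)) \<longlonglongrightarrow> 0"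
    "\<And>i. (\<lambda>k. l2_norm \<Omega> (\<lambda>x. pderiv_at i (\<phi> k) x - g i x)) \<longlonglongrightarrow> 0"
    using assms(1) by (auto simp: dirichlet_gradient_def)
  obtain \<psi> where \<psi>: "\<And>k. \<psi> k \<in> test_functions \<Omega>" "(\<lambda>k. l2_norm \<Omega> (\<lambda>x. \<psi> k x - u x)) \<longlonglongrightarrow> 0"
    "\<And>i. (\<lambda>k. l2_norm \<Omega> (\<lambda>x. pderiv_at i (\<psi> k) x - v i x)) \<longlonglongrightarrow> 0"
    using assms(2) by (auto simp: dirichlet_gradient_def)
  have lim: "(\<lambda>k. l2_norm \<Omega> (\<lambda>x. (a k x - b k x) - (a' x - b' x))) \<longlonglongrightarrow> 0"
    if "\<And>k. a k \<in> L2 \<Omega>" "\<And>k. b k \<in> L2 \<Omega>" "a' \<in> L2 \<Omega>" "b' \<in> L2 \<Omega>"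
      "(\<lambda>k. l2_norm \<Omega> (\<lambda>x. a k x - a' x)) \<longlonglongrightarrow> 0" "(\<lambda>k. l2_norm \<Omega> (\<lambda>x. b k x - b' x)) \<longlonglongrightarrow> 0"
    for a b :: "nat \<Rightarrow> 'n fld" and a' b'
  proof (rule tendsto_sandwich[OF _ _ tendsto_const])
    show "(\<lambda>k. l2_norm \<Omega> (\<lambda>x. a k x - a' x) + l2_norm \<Omega> (\<lambda>x. b k x - b' x)) \<longlonglongrightarrow> 0"
      using tendsto_add[OF that(5,6)] by simp
    have "l2_norm \<Omega> (\<lambda>x. (a k x - b k x) - (a' x - b' x)) \<le> l2_norm \<Omega> (\<lambda>x. a k x - a' x) + l2_norm \<Omega> (\<lambda>x. b k x - b' x)" for k
      using l2_norm_triangle[OF L2_diff[OF that(1,3)] L2_diff[OF that(4,2)], of k k] l2_norm_minus_commute[of \<Omega> b' "b k"]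
      by (simp add: algebra_simps)
    then show "\<forall>\<^sub>F k in sequentially. l2_norm \<Omega> (\<lambda>x. (a k x - b k x) - (a' x - b' x)) \<le> l2_norm \<Omega> (\<lambda>x. a k x - a' x) + l2_norm \<Omega> (\<lambda>x. b k x - b' x)"
      by simp
  qed auto
  show ?thesis
    unfolding dirichlet_gradient_def
  proof (intro conjI allI exI[of _ "\<lambda>k x. \<phi> k x - \<psi> k x"])
    show "(\<lambda>k. l2_norm \<Omega> (\<lambda>x. \<phi> k x - \<psi> k x - (f x - u x))) \<longlonglongrightarrow> 0"
      by (intro lim test_functions_L2 \<phi> \<psi> L2)
    show "(\<lambda>k. l2_norm \<Omega> (\<lambda>x. pderiv_at i (\<lambda>x. \<phi> k x - \<psi> k x) x - (g i x - v i x))) \<longlonglongrightarrow> 0" for i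
      unfolding pderiv_at_diff[OF test_functions_smooth[OF \<phi>(1)] test_functions_smooth[OF \<psi>(1)]]
      by (intro lim pderiv_at_L2 \<phi> \<psi> L2)
  qed (auto intro: L2_diff L2 test_functions_diff \<phi> \<psi>)
qed

lemma smooth_bounded_on_domain:
  assumes "smooth m"
  obtains C where "\<And>x. x \<in> \<Omega> \<Longrightarrow> cmod (m x) \<le> C" "C \<ge> 0"
proof -
  have "bounded (m ` closure \<Omega>)"
    using bounded_domain assms
    by (intro compact_imp_bounded compact_continuous_image smooth_continuous_on) (simp_all add: compact_closure)
  then obtain C where "\<And>x. x \<in> closure \<Omega> \<Longrightarrow> cmod (m x) \<le> C" unfolding bounded_iff by blast
  then show ?thesis using that[of "max C 0"] closure_subset[of \<Omega>] by (auto simp: le_max_iff_disj)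
qed

lemma L2_mult_smooth: "smooth m \<Longrightarrow> f \<in> L2 \<Omega> \<Longrightarrow> (\<lambda>x. m x * f x) \<in> L2 \<Omega>"
  using L2_mult_bounded measurable_smooth smooth_bounded_on_domain by metis

text \<open>Multiplying the approximating test functions by \<open>m\<close> gives test functions
  again, and \<open>m\<close> and its derivatives are bounded on \<Omega>. This is what makes m f an
  admissible element to test the equation with.\<close>

lemma dirichlet_gradient_mult:
  assumes "dirichlet_gradient f g" "smooth m"
  shows "dirichlet_gradient (\<lambda>x. m x * f x) (\<lambda>i x. m x * g i x + pderiv_at i m x * f x)"
proof -
  note L2 = dirichlet_gradient_L2[OF assms(1)]
  note smp = smooth_pderiv_at[OF assms(2)]
  obtain \<phi> where \<phi>: "\<And>k. \<phi> k \<in> test_functions \<Omega>" "(\<lambda>k. l2_norm \<Omega> (\<lambda>x. \<phi> k x - f x)) \<longlonglongrightarrow> 0"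
    "\<And>i. (\<lambda>k. l2_norm \<Omega> (\<lambda>x. pderiv_at i (\<phi> k) x - g i x)) \<longlonglongrightarrow> 0"
    using assms(1) by (auto simp: dirichlet_gradient_def)
  note \<phi>L2 = test_functions_L2[OF \<phi>(1)] pderiv_at_L2[OF \<phi>(1)]
  have lim: "(\<lambda>k. l2_norm \<Omega> (\<lambda>x. w x * (a k x - a' x))) \<longlonglongrightarrow> 0"
    if "smooth w" "\<And>k. a k \<in> L2 \<Omega>" "a' \<in> L2 \<Omega>" "(\<lambda>k. l2_norm \<Omega> (\<lambda>x. a k x - a' x)) \<longlonglongrightarrow> 0" for w a a'
  proof -
    obtain C where C: "\<And>x. x \<in> \<Omega> \<Longrightarrow> cmod (w x) \<le> C" "C \<ge> 0"
      using smooth_bounded_on_domain[OF \<open>smooth w\<close>] by blast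
    show ?thesis
    proof (rule tendsto_sandwich[OF _ _ tendsto_const])
      show "(\<lambda>k. C * l2_norm \<Omega> (\<lambda>x. a k x - a' x)) \<longlonglongrightarrow> 0"
        using tendsto_mult_right_zero[OF that(4)] .
      show "\<forall>\<^sub>F k in sequentially. l2_norm \<Omega> (\<lambda>x. w x * (a k x - a' x)) \<le> C * l2_norm \<Omega> (\<lambda>x. a k x - a' x)"
        using C that(1) by (intro always_eventually allI l2_norm_mult_le L2_diff that measurable_smooth)
    qed auto
  qed
  show ?thesis
    unfolding dirichlet_gradient_def
  proof (intro conjI allI exI[of _ "\<lambda>k x. m x * \<phi> k x"])
    show "(\<lambda>k. l2_norm \<Omega> (\<lambda>x. m x * \<phi> k x - m x * f x)) \<longlonglongrightarrow> 0"
      using lim[OF assms(2) \<phi>L2(1) L2(1) \<phi>(2)] by (simp add: right_diff_distrib)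
    fix i
    let ?a = "\<lambda>k x. m x * (pderiv_at i (\<phi> k) x - g i x)" and ?b = "\<lambda>k x. pderiv_at i m x * (\<phi> k x - f x)"
    show "(\<lambda>k. l2_norm \<Omega> (\<lambda>x. pderiv_at i (\<lambda>x. m x * \<phi> k x) x - (m x * g i x + pderiv_at i m x * f x))) \<longlonglongrightarrow> 0"
    proof (rule tendsto_sandwich[OF _ _ tendsto_const])
      show "(\<lambda>k. l2_norm \<Omega> (?a k) + l2_norm \<Omega> (?b k)) \<longlonglongrightarrow> 0"
        using tendsto_add[OF lim[OF assms(2) \<phi>L2(2) L2(2) \<phi>(3)[of i]] lim[OF smp \<phi>L2(1) L2(1) \<phi>(2)]] by simp
      have "pderiv_at i (\<lambda>x. m x * \<phi> k x) x - (m x * g i x + pderiv_at i m x * f x) = ?a k x + ?b k x" for k x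
        using pderiv_at_mult[OF smooth_differentiable[OF assms(2)] smooth_differentiable[OF test_functions_smooth[OF \<phi>(1)]]]
        by (simp add: algebra_simps)
      then show "\<forall>\<^sub>F k in sequentially. l2_norm \<Omega> (\<lambda>x. pderiv_at i (\<lambda>x. m x * \<phi> k x) x - (m x * g i x + pderiv_at i m x * f x))
          \<le> l2_norm \<Omega> (?a k) + l2_norm \<Omega> (?b k)"
        using assms(2) smp L2 \<phi>L2
        by (auto intro!: always_eventually l2_norm_triangle L2_mult_smooth L2_diff)
    qed auto
  qed (use assms smp L2 in \<open>auto intro!: L2_mult_smooth L2_add test_functions_mult \<phi>\<close>)
qed

end

section \<open>Weak solutions\<close>

text \<open>The discriminant bound, read off at the minimizer t = -R/E. In its application
  \<open>d\<close> is the gap to the infimum, and \<open>R\<close> is the error in the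
  Euler-Lagrange equation.\<close>

lemma abs_le_sqrt_mult_if_quadratic_nonneg:
  fixes R E d :: real
  assumes "\<And>t. 0 \<le> t\<^sup>2 * E + 2 * t * R + d" "E \<ge> 0" "d \<ge> 0"
  shows "\<bar>R\<bar> \<le> sqrt E * sqrt d"
proof (cases "E = 0")
  case True
  have "R = 0"
  proof (rule ccontr)
    assume "R \<noteq> 0"
    \<comment> \<open>At this \<open>t\<close> the expression, now linear in \<open>t\<close>,
      equals -1.\<close>
    then show False using assms(1)[of "- (d + 1) / (2 * R)"] True by (simp add: field_simps)
  qed
  then show ?thesis using True by simp
next
  case False
  have "(- R / E)\<^sup>2 * E + 2 * (- R / E) * R + d = d - R\<^sup>2 / E"
    using False by (simp add: field_simps power2_eq_square)
  then have "R\<^sup>2 / E \<le> d" using assms(1)[of "- R / E"] by simp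
  then have "R\<^sup>2 \<le> E * d"
    using False assms(2) by (simp add: field_simps)
  then have "sqrt (R\<^sup>2) \<le> sqrt (E * d)" by (rule real_sqrt_le_mono)
  then show ?thesis by (simp add: real_sqrt_mult)
qed

lemma l2_norm_square_add:
  assumes "f \<in> L2 \<Omega>" "g \<in> L2 \<Omega>"
  shows "(l2_norm \<Omega> (\<lambda>x. f x + g x))\<^sup>2 = (l2_norm \<Omega> f)\<^sup>2 + (l2_norm \<Omega> g)\<^sup>2 + 2 * Re (l2_inner \<Omega> f g)"
proof -
  have "complex_of_real ((l2_norm \<Omega> (\<lambda>x. f x + g x))\<^sup>2) = l2_inner \<Omega> (\<lambda>x. f x + g x) (\<lambda>x. f x + g x)"
    using assms by (simp only: l2_inner_self L2_add)
  also have "\<dots> = l2_inner \<Omega> f f + l2_inner \<Omega> f g + (cnj (l2_inner \<Omega> f g) + l2_inner \<Omega> g g)"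
    using assms by (simp add: L2_add l2_inner_add_left l2_inner_add_right l2_inner_commute[of \<Omega> g f])
  also have "Re \<dots> = (l2_norm \<Omega> f)\<^sup>2 + (l2_norm \<Omega> g)\<^sup>2 + 2 * Re (l2_inner \<Omega> f g)"
    using assms by (simp add: l2_inner_self)
  finally show ?thesis by simp
qed

text \<open>Pointwise the integrand is w cnj(v) |f|^2. The energy bound uses it with v = 1, the
  rotated potential with v = m, and the gradient term with w = 1, v = m and \<open>f\<close> a
  derivative.\<close>

lemma Re_l2_inner_mult_ge:
  assumes f: "f \<in> L2 \<Omega>" "(\<lambda>x. w x * f x) \<in> L2 \<Omega>" "(\<lambda>x. v x * f x) \<in> L2 \<Omega>"
    and "\<And>x. x \<in> \<Omega> \<Longrightarrow> c \<le> Re (w x * cnj (v x))"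
  shows "c * (l2_norm \<Omega> f)\<^sup>2 \<le> Re (l2_inner \<Omega> (\<lambda>x. w x * f x) (\<lambda>x. v x * f x))"
proof -
  have int: "integrable (lebesgue_on \<Omega>) (\<lambda>x. (w x * f x) * cnj (v x * f x))"
    using f by (intro L2_integrable_inner)
  have eq: "Re ((w x * f x) * cnj (v x * f x)) = Re (w x * cnj (v x)) * (cmod (f x))\<^sup>2" for x
  proof -
    have "(w x * f x) * cnj (v x * f x) = (w x * cnj (v x)) * complex_of_real ((cmod (f x))\<^sup>2)"
      unfolding complex_norm_square by (simp add: mult_ac)
    then show ?thesis by (simp only: Re_complex_of_real times_complex.sel Im_complex_of_real mult_zero_right diff_zero)
  qed
  have "c * (l2_norm \<Omega> f)\<^sup>2 = (\<integral>x. c * (cmod (f x))\<^sup>2 \<partial>(lebesgue_on \<Omega>))"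
    by (simp add: l2_norm_square)
  also have "\<dots> \<le> (\<integral>x. Re ((w x * f x) * cnj (v x * f x)) \<partial>(lebesgue_on \<Omega>))"
  proof (rule integral_mono)
    show "integrable (lebesgue_on \<Omega>) (\<lambda>x. c * (cmod (f x))\<^sup>2)" using f by (simp add: L2_integrable_square)
    show "integrable (lebesgue_on \<Omega>) (\<lambda>x. Re ((w x * f x) * cnj (v x * f x)))" using int by (rule integrable_Re)
    show "c * (cmod (f x))\<^sup>2 \<le> Re ((w x * f x) * cnj (v x * f x))" if "x \<in> space (lebesgue_on \<Omega>)" for x
      unfolding eq using that assms(4) by (intro mult_right_mono) auto
  qed
  also have "\<dots> = Re (l2_inner \<Omega> (\<lambda>x. w x * f x) (\<lambda>x. v x * f x))"
    unfolding l2_inner_def using int by (rule integral_Re)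
  finally show ?thesis .
qed

context bounded_domain
begin

text \<open>The weak form of -h^2 \<Delta>f + W f = k. A general potential \<open>W\<close> absorbs
  both the spectral parameter and the shifts by s.\<close>

definition weak_solution :: "real \<Rightarrow> 'n fld \<Rightarrow> 'n fld \<Rightarrow> 'n fld \<Rightarrow> bool" where
  "weak_solution h W k f \<longleftrightarrow> f \<in> W12_0 \<Omega> \<and>
     (\<forall>u\<in>W12_0 \<Omega>. of_real (h\<^sup>2) * dirichlet_form \<Omega> f u + l2_inner \<Omega> (\<lambda>x. W x * f x) u = l2_inner \<Omega> k u)"

definition bounded_potential :: "'n fld \<Rightarrow> bool" where
  "bounded_potential W \<longleftrightarrow> W \<in> borel_measurable (lebesgue_on \<Omega>) \<and> (\<exists>C. \<forall>x\<in>\<Omega>. cmod (W x) \<le> C)"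

lemma L2_mult_potential: "bounded_potential W \<Longrightarrow> f \<in> L2 \<Omega> \<Longrightarrow> (\<lambda>x. W x * f x) \<in> L2 \<Omega>"
  unfolding bounded_potential_def using L2_mult_bounded by blast

lemma W12_0_L2: "f \<in> W12_0 \<Omega> \<Longrightarrow> f \<in> L2 \<Omega>"
  by (simp add: W12_0_def W12_def)

lemma weak_solution_L2: "weak_solution h W k f \<Longrightarrow> f \<in> L2 \<Omega>"
  by (simp add: weak_solution_def W12_0_L2)

text \<open>The Dirichlet form is positive, so \<open>-h\<^sup>2\<Delta> + s\<close> is inverted by minimizing the quadratic functional
  \<open>E(\<phi>) - 2 Re \<langle>k, \<phi>\<rangle>\<close>; a minimizing sequence can be taken from the test functions.\<close>

lemma weak_solution_positive_constant:
  assumes "h > 0" "s > 0" and k: "k \<in> L2 \<Omega>"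
  shows "\<exists>f. weak_solution h (\<lambda>_. of_real s) k f"
proof -
  let ?T = "test_functions \<Omega>"
  note T_L2 = test_functions_L2 pderiv_at_L2
  define E where "E \<phi> = h\<^sup>2 * (\<Sum>i\<in>UNIV. (l2_norm \<Omega> (pderiv_at i \<phi>))\<^sup>2) + s * (l2_norm \<Omega> \<phi>)\<^sup>2" for \<phi> :: "'n fld"
  define B where "B \<phi> u = of_real (h\<^sup>2) * (\<Sum>i\<in>UNIV. l2_inner \<Omega> (pderiv_at i \<phi>) (pderiv_at i u)) + of_real s * l2_inner \<Omega> \<phi> u"
    for \<phi> u :: "'n fld"
  define J where "J \<phi> = E \<phi> - 2 * Re (l2_inner \<Omega> k \<phi>)" for \<phi>
  have E_nonneg: "E \<phi> \<ge> 0" for \<phi> using assms(2) by (simp add: E_def sum_nonneg)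
  have E_add: "E (\<lambda>x. \<phi> x + u x) = E \<phi> + E u + 2 * Re (B \<phi> u)" if "\<phi> \<in> ?T" "u \<in> ?T" for \<phi> u
    using that by (simp add: E_def B_def l2_norm_square_add T_L2 sum.distrib pderiv_at_add
        smooth_differentiable test_functions_smooth algebra_simps sum_distrib_left)
  have E_self: "E u = Re (B u u)" if "u \<in> ?T" for u
    using that by (simp add: E_def B_def l2_inner_self T_L2)
  have E_scale: "E (\<lambda>x. of_real t * u x) = t\<^sup>2 * E u" if "u \<in> ?T" for t u
    using that by (simp add: E_def pderiv_at_cmult test_functions_smooth l2_norm_cmult power_mult_distrib algebra_simps sum_distrib_left)
  have B_scale: "B \<phi> (\<lambda>x. c * u x) = cnj c * B \<phi> u" if "u \<in> ?T" for c \<phi> u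
    using that by (simp add: B_def pderiv_at_cmult test_functions_smooth l2_inner_cmult_right algebra_simps sum_distrib_left)
  have B_diff: "B (\<lambda>x. \<phi> x - \<psi> x) u = B \<phi> u - B \<psi> u" if "\<phi> \<in> ?T" "\<psi> \<in> ?T" "u \<in> ?T" for \<phi> \<psi> u
    using that by (simp add: B_def pderiv_at_diff test_functions_smooth l2_inner_diff_left T_L2 algebra_simps sum_subtractf)
  \<comment> \<open>Completing the square in the norm of \<phi>; the positive constant
    \<open>s\<close> makes the functional bounded below.\<close>
  have J_bound: "J \<phi> \<ge> - (l2_norm \<Omega> k)\<^sup>2 / s" if "\<phi> \<in> ?T" for \<phi>
  proof -
    let ?a = "l2_norm \<Omega> \<phi>" and ?b = "l2_norm \<Omega> k"
    have "Re (l2_inner \<Omega> k \<phi>) \<le> ?b * ?a"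
      using l2_Cauchy_Schwarz[OF k T_L2(1)[OF that]] complex_Re_le_cmod order_trans by blast
    moreover have "s * ?a\<^sup>2 \<le> E \<phi>" by (simp add: E_def sum_nonneg)
    moreover have "0 \<le> s * (?a - ?b / s)\<^sup>2" using assms(2) by simp
    moreover have "s * (?a - ?b / s)\<^sup>2 = s * ?a\<^sup>2 - 2 * (?b * ?a) + ?b\<^sup>2 / s"
      using assms(2) by (simp add: power2_eq_square field_simps)
    ultimately show ?thesis by (simp add: J_def)
  qed
  have bdd: "bdd_below (J ` ?T)" using J_bound by (intro bdd_belowI2)
  have ne: "J ` ?T \<noteq> {}" using zero_test_function by blast
  define \<delta> where "\<delta> n = inverse (real (Suc n))" for n
  have \<delta>: "\<delta> n > 0" for n by (simp add: \<delta>_def)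
  have \<delta>_lim: "(\<lambda>n. sqrt (\<delta> n)) \<longlonglongrightarrow> 0"
    using tendsto_real_sqrt[OF LIMSEQ_inverse_real_of_nat] by (simp add: \<delta>_def)
  have "\<exists>\<phi>\<in>?T. J \<phi> < Inf (J ` ?T) + \<delta> n" for n
    using cInf_lessD[OF ne, of "Inf (J ` ?T) + \<delta> n"] \<delta> by auto
  then obtain \<phi> where \<phi>: "\<And>n. \<phi> n \<in> ?T" "\<And>n. J (\<phi> n) < Inf (J ` ?T) + \<delta> n" by metis
  \<comment> \<open>Near-minimality along the line through \<open>\<phi> n\<close> in direction
    \<open>u\<close> is a nonnegative quadratic in \<open>t\<close>; its discriminant bounds the
    defect of the Euler-Lagrange equation.\<close>
  have Euler: "\<bar>Re (B (\<phi> n) u - l2_inner \<Omega> k u)\<bar> \<le> sqrt (E u) * sqrt (\<delta> n)" if u: "u \<in> ?T" for n u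
  proof (rule abs_le_sqrt_mult_if_quadratic_nonneg)
    fix t :: real
    have tu: "(\<lambda>x. of_real t * u x) \<in> ?T" using u by (rule test_functions_cmult)
    have "Inf (J ` ?T) \<le> J (\<lambda>x. \<phi> n x + of_real t * u x)"
      using bdd tu \<phi>(1) by (intro cInf_lower imageI test_functions_add)
    also have "\<dots> = J (\<phi> n) + t\<^sup>2 * E u + 2 * t * Re (B (\<phi> n) u - l2_inner \<Omega> k u)"
      using \<phi>(1)[of n] u tu k
      by (simp add: J_def E_add E_scale B_scale l2_inner_add_right l2_inner_cmult_right T_L2 algebra_simps)
    finally show "0 \<le> t\<^sup>2 * E u + 2 * t * Re (B (\<phi> n) u - l2_inner \<Omega> k u) + \<delta> n"
      using \<phi>(2)[of n] by simp
  qed (use E_nonneg \<delta> less_imp_le in auto)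
  \<comment> \<open>Subtracting the approximate equations for \<open>m\<close> and \<open>n\<close>,
    tested with the difference \<open>?u\<close>, leaves \<open>E ?u\<close> on the left; one factor
    \<open>sqrt (E ?u)\<close> cancels.\<close>
  have E_Cauchy: "sqrt (E (\<lambda>x. \<phi> m x - \<phi> n x)) \<le> sqrt (\<delta> m) + sqrt (\<delta> n)" for m n
  proof -
    let ?u = "\<lambda>x. \<phi> m x - \<phi> n x"
    have u: "?u \<in> ?T" using \<phi>(1) by (intro test_functions_diff)
    have "E ?u = Re (B (\<phi> m) ?u - l2_inner \<Omega> k ?u) - Re (B (\<phi> n) ?u - l2_inner \<Omega> k ?u)"
      using E_self[OF u] B_diff[OF \<phi>(1) \<phi>(1) u] by simp
    also have "\<dots> \<le> sqrt (E ?u) * sqrt (\<delta> m) + sqrt (E ?u) * sqrt (\<delta> n)"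
      using Euler[OF u, of m] Euler[OF u, of n] by linarith
    finally have le: "sqrt (E ?u) * sqrt (E ?u) \<le> sqrt (E ?u) * (sqrt (\<delta> m) + sqrt (\<delta> n))"
      using E_nonneg by (simp add: algebra_simps)
    show ?thesis
    proof (cases "E ?u = 0")
      case True
      then show ?thesis using \<delta>[THEN less_imp_le] by simp
    next
      case False
      then have "0 < sqrt (E ?u)" using E_nonneg[of ?u] by simp
      then show ?thesis using le by (rule mult_left_le_imp_le[rotated])
    qed
  qed
  \<comment> \<open>Stated for any sequence controlled by the energy distance: it serves
    \<open>\<phi>\<close> itself with factor \<open>sqrt s\<close> and its partial derivatives with
    factor \<open>h\<close>.\<close>
  have Cauchy: "\<exists>N. \<forall>m\<ge>N. \<forall>n\<ge>N. l2_norm \<Omega> (\<lambda>x. d m x - d n x) < e"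
    if c: "c > 0" and le: "\<And>m n. c * l2_norm \<Omega> (\<lambda>x. d m x - d n x) \<le> sqrt (E (\<lambda>x. \<phi> m x - \<phi> n x))" and "e > 0"
    for c e and d :: "nat \<Rightarrow> 'n fld"
  proof -
    have "\<forall>\<^sub>F n in sequentially. sqrt (\<delta> n) < c * e / 2"
      using \<delta>_lim c \<open>e > 0\<close> by (intro order_tendstoD) auto
    then obtain N where N: "\<And>n. n \<ge> N \<Longrightarrow> sqrt (\<delta> n) < c * e / 2" by (auto simp: eventually_sequentially)
    have "l2_norm \<Omega> (\<lambda>x. d m x - d n x) < e" if "m \<ge> N" "n \<ge> N" for m n
    proof -
      have "c * l2_norm \<Omega> (\<lambda>x. d m x - d n x) < c * e"
        using le[of m n] E_Cauchy[of m n] N[OF that(1)] N[OF that(2)] by linarith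
      then show ?thesis using c by simp
    qed
    then show ?thesis by blast
  qed
  have "sqrt s * l2_norm \<Omega> (\<lambda>x. \<phi> m x - \<phi> n x) \<le> sqrt (E (\<lambda>x. \<phi> m x - \<phi> n x))" for m n
    using assms(2) by (intro real_le_rsqrt) (simp add: power_mult_distrib E_def sum_nonneg)
  note Cauchy_f = Cauchy[OF _ this]
  obtain f where f: "f \<in> L2 \<Omega>" "(\<lambda>n. l2_norm \<Omega> (\<lambda>x. \<phi> n x - f x)) \<longlonglongrightarrow> 0"
  proof (rule L2_complete[of \<Omega> \<phi>])
    show "\<exists>N. \<forall>m\<ge>N. \<forall>n\<ge>N. l2_norm \<Omega> (\<lambda>x. \<phi> m x - \<phi> n x) < e" if "e > 0" for e
      using Cauchy_f[OF _ that] assms(2) by simp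
  qed (rule finite_measure_domain T_L2(1)[OF \<phi>(1)])+
  have "h * l2_norm \<Omega> (\<lambda>x. pderiv_at i (\<phi> m) x - pderiv_at i (\<phi> n) x) \<le> sqrt (E (\<lambda>x. \<phi> m x - \<phi> n x))" for i m n
  proof (rule real_le_rsqrt)
    have "(l2_norm \<Omega> (pderiv_at i (\<lambda>x. \<phi> m x - \<phi> n x)))\<^sup>2 \<le> (\<Sum>i\<in>UNIV. (l2_norm \<Omega> (pderiv_at i (\<lambda>x. \<phi> m x - \<phi> n x)))\<^sup>2)"
      by (rule member_le_sum) auto
    moreover have "pderiv_at i (\<lambda>x. \<phi> m x - \<phi> n x) = (\<lambda>x. pderiv_at i (\<phi> m) x - pderiv_at i (\<phi> n) x)"
      using \<phi>(1) by (intro pderiv_at_diff test_functions_smooth)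
    ultimately have "h\<^sup>2 * (l2_norm \<Omega> (\<lambda>x. pderiv_at i (\<phi> m) x - pderiv_at i (\<phi> n) x))\<^sup>2
        \<le> h\<^sup>2 * (\<Sum>i\<in>UNIV. (l2_norm \<Omega> (pderiv_at i (\<lambda>x. \<phi> m x - \<phi> n x)))\<^sup>2)"
      by (intro mult_left_mono) auto
    also have "\<dots> \<le> E (\<lambda>x. \<phi> m x - \<phi> n x)" using assms(2) by (simp add: E_def)
    finally show "(h * l2_norm \<Omega> (\<lambda>x. pderiv_at i (\<phi> m) x - pderiv_at i (\<phi> n) x))\<^sup>2 \<le> E (\<lambda>x. \<phi> m x - \<phi> n x)"
      by (simp add: power_mult_distrib)
  qed
  note Cauchy_g = Cauchy[OF assms(1) this]
  have "\<exists>g. g \<in> L2 \<Omega> \<and> (\<lambda>n. l2_norm \<Omega> (\<lambda>x. pderiv_at i (\<phi> n) x - g x)) \<longlonglongrightarrow> 0" for i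
  proof (rule L2_complete[of \<Omega> "\<lambda>n. pderiv_at i (\<phi> n)"])
    show "\<exists>N. \<forall>m\<ge>N. \<forall>n\<ge>N. l2_norm \<Omega> (\<lambda>x. pderiv_at i (\<phi> m) x - pderiv_at i (\<phi> n) x) < e" if "e > 0" for e
      using Cauchy_g[OF that] .
    show "\<exists>g. g \<in> L2 \<Omega> \<and> (\<lambda>n. l2_norm \<Omega> (\<lambda>x. pderiv_at i (\<phi> n) x - g x)) \<longlonglongrightarrow> 0"
      if "g \<in> L2 \<Omega>" "(\<lambda>n. l2_norm \<Omega> (\<lambda>x. pderiv_at i (\<phi> n) x - g x)) \<longlonglongrightarrow> 0" for g
      using that by blast
  qed (rule finite_measure_domain T_L2(2)[OF \<phi>(1)])+
  then have "\<forall>i. \<exists>g. g \<in> L2 \<Omega> \<and> (\<lambda>n. l2_norm \<Omega> (\<lambda>x. pderiv_at i (\<phi> n) x - g x)) \<longlonglongrightarrow> 0" ..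
  from choice[OF this] obtain g where "\<forall>i. g i \<in> L2 \<Omega> \<and> (\<lambda>n. l2_norm \<Omega> (\<lambda>x. pderiv_at i (\<phi> n) x - g i x)) \<longlonglongrightarrow> 0" ..
  then have g: "\<And>i. g i \<in> L2 \<Omega>" "\<And>i. (\<lambda>n. l2_norm \<Omega> (\<lambda>x. pderiv_at i (\<phi> n) x - g i x)) \<longlonglongrightarrow> 0" by simp_all
  have dg: "dirichlet_gradient f g"
    using f g \<phi>(1) by (auto simp: dirichlet_gradient_def)
  define D where "D u v = of_real (h\<^sup>2) * (\<Sum>i\<in>UNIV. l2_inner \<Omega> (g i) (v i)) + of_real s * l2_inner \<Omega> f u - l2_inner \<Omega> k u"
    for u :: "'n fld" and v :: "'n \<Rightarrow> 'n fld"
  have Re0: "Re (D u (\<lambda>i. pderiv_at i u)) = 0" if u: "u \<in> ?T" for u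
  proof -
    have "(\<lambda>n. Re (B (\<phi> n) u - l2_inner \<Omega> k u)) \<longlonglongrightarrow> Re (D u (\<lambda>i. pderiv_at i u))"
      unfolding B_def D_def using u \<phi>(1)
      by (intro tendsto_intros l2_inner_tendsto f g T_L2)
    moreover have "(\<lambda>n. Re (B (\<phi> n) u - l2_inner \<Omega> k u)) \<longlonglongrightarrow> 0"
      by (rule Lim_null_comparison[OF _ tendsto_mult_right_zero[OF \<delta>_lim, of "sqrt (E u)"]])
         (use Euler[OF u] in simp)
    ultimately show ?thesis by (rule LIMSEQ_unique)
  qed
  \<comment> \<open>Real variations \<open>t\<close> see only the real part. Since D(iu) = -i D(u),
    the direction iu supplies the imaginary part.\<close>
  have D0: "D u (\<lambda>i. pderiv_at i u) = 0" if u: "u \<in> ?T" for u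
  proof -
    have "D (\<lambda>x. \<i> * u x) (\<lambda>i. pderiv_at i (\<lambda>x. \<i> * u x)) = - \<i> * D u (\<lambda>i. pderiv_at i u)"
      using u by (simp add: D_def pderiv_at_cmult test_functions_smooth l2_inner_cmult_right algebra_simps sum_negf sum_distrib_left)
    then have "Im (D u (\<lambda>i. pderiv_at i u)) = 0"
      using Re0[OF test_functions_cmult[OF u, of \<i>]] by simp
    then show ?thesis using Re0[OF u] by (simp add: complex_eq_iff)
  qed
  have "weak_solution h (\<lambda>_. of_real s) k f"
    unfolding weak_solution_def
  proof (intro conjI ballI)
    show "f \<in> W12_0 \<Omega>" using dg by (rule dirichlet_gradient_W12_0)
    fix u assume "u \<in> W12_0 \<Omega>"
    then obtain v where uv: "dirichlet_gradient u v" by (rule W12_0_dirichlet_gradient)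
    then obtain \<psi> where \<psi>: "\<And>k. \<psi> k \<in> ?T" "(\<lambda>k. l2_norm \<Omega> (\<lambda>x. \<psi> k x - u x)) \<longlonglongrightarrow> 0"
      "\<And>i. (\<lambda>k. l2_norm \<Omega> (\<lambda>x. pderiv_at i (\<psi> k) x - v i x)) \<longlonglongrightarrow> 0"
      by (auto simp: dirichlet_gradient_def)
    \<comment> \<open>The equation holds against test functions and passes to all of
      \<open>W12_0\<close> by continuity in the pair of \<open>u\<close> and its gradient.\<close>
    have "(\<lambda>n. D (\<psi> n) (\<lambda>i. pderiv_at i (\<psi> n))) \<longlonglongrightarrow> D u v"
      unfolding D_def
      by (intro tendsto_intros l2_inner_tendsto_right dirichlet_gradient_L2[OF uv] \<psi> f g k T_L2[OF \<psi>(1)])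
    then have "D u v = 0" by (simp add: D0[OF \<psi>(1)] LIMSEQ_const_iff)
    then show "of_real (h\<^sup>2) * dirichlet_form \<Omega> f u + l2_inner \<Omega> (\<lambda>x. of_real s * f x) u = l2_inner \<Omega> k u"
      by (simp add: dirichlet_form_eq[OF dg uv] D_def l2_inner_cmult_left)
  qed
  then show ?thesis by blast
qed

section \<open>Stability of solvability under perturbation of the potential\<close>

lemma weak_solution_diff:
  assumes "weak_solution h W k f" "weak_solution h W k' f'"
    and W: "bounded_potential W" and k: "k \<in> L2 \<Omega>" "k' \<in> L2 \<Omega>"
  shows "weak_solution h W (\<lambda>x. k x - k' x) (\<lambda>x. f x - f' x)"
proof -
  obtain g where g: "dirichlet_gradient f g"
    using assms(1) W12_0_dirichlet_gradient by (auto simp: weak_solution_def)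
  obtain g' where g': "dirichlet_gradient f' g'"
    using assms(2) W12_0_dirichlet_gradient by (auto simp: weak_solution_def)
  note L2 = dirichlet_gradient_L2[OF g] dirichlet_gradient_L2[OF g']
  note d = dirichlet_gradient_diff[OF g g']
  show ?thesis
    unfolding weak_solution_def
  proof (intro conjI ballI)
    show "(\<lambda>x. f x - f' x) \<in> W12_0 \<Omega>" using d by (rule dirichlet_gradient_W12_0)
    fix u assume u: "u \<in> W12_0 \<Omega>"
    then obtain v where v: "dirichlet_gradient u v" by (rule W12_0_dirichlet_gradient)
    note L2v = dirichlet_gradient_L2[OF v]
    have "dirichlet_form \<Omega> (\<lambda>x. f x - f' x) u = dirichlet_form \<Omega> f u - dirichlet_form \<Omega> f' u"
      by (simp add: dirichlet_form_eq[OF g v] dirichlet_form_eq[OF g' v] dirichlet_form_eq[OF d v]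
          l2_inner_diff_left L2 L2v sum_subtractf)
    moreover have "l2_inner \<Omega> (\<lambda>x. W x * (f x - f' x)) u = l2_inner \<Omega> (\<lambda>x. W x * f x) u - l2_inner \<Omega> (\<lambda>x. W x * f' x) u"
      using L2_mult_potential[OF W] L2 L2v by (simp add: l2_inner_diff_left right_diff_distrib)
    moreover have "of_real (h\<^sup>2) * dirichlet_form \<Omega> f u + l2_inner \<Omega> (\<lambda>x. W x * f x) u = l2_inner \<Omega> k u"
      "of_real (h\<^sup>2) * dirichlet_form \<Omega> f' u + l2_inner \<Omega> (\<lambda>x. W x * f' x) u = l2_inner \<Omega> k' u"
      using assms(1,2) u by (auto simp: weak_solution_def)
    moreover have "l2_inner \<Omega> (\<lambda>x. k x - k' x) u = l2_inner \<Omega> k u - l2_inner \<Omega> k' u"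
      using k L2v by (intro l2_inner_diff_left)
    ultimately show "of_real (h\<^sup>2) * dirichlet_form \<Omega> (\<lambda>x. f x - f' x) u + l2_inner \<Omega> (\<lambda>x. W x * (f x - f' x)) u
        = l2_inner \<Omega> (\<lambda>x. k x - k' x) u"
      by (simp add: right_diff_distrib) (simp add: algebra_simps)
  qed
qed

text \<open>The convergence half of the contraction principle, by summing a geometric series.
  \<open>l2_norm\<close> is only a seminorm on functions, so the limit is determined up to null
  sets.\<close>

lemma L2_contraction_limit:
  fixes F :: "nat \<Rightarrow> 'n fld"
  assumes F: "\<And>n. F n \<in> L2 \<Omega>" and q: "0 \<le> q" "q < 1"
    and step: "\<And>n. l2_norm \<Omega> (\<lambda>x. F (Suc (Suc n)) x - F (Suc n) x) \<le> q * l2_norm \<Omega> (\<lambda>x. F (Suc n) x - F n x)"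
  obtains G where "G \<in> L2 \<Omega>" "(\<lambda>n. l2_norm \<Omega> (\<lambda>x. F n x - G x)) \<longlonglongrightarrow> 0"
proof (rule L2_complete[OF finite_measure_domain F])
  define D where "D = l2_norm \<Omega> (\<lambda>x. F (Suc 0) x - F 0 x)"
  have le: "l2_norm \<Omega> (\<lambda>x. F (Suc n) x - F n x) \<le> D * q ^ n" for n
  proof (induction n)
    case (Suc n)
    from mult_left_mono[OF Suc q(1)] step[of n] show ?case by (simp add: mult_ac)
  qed (simp add: D_def)
  have le': "l2_norm \<Omega> (\<lambda>x. F (m + j) x - F m x) \<le> D * q ^ m * (\<Sum>i<j. q ^ i)" for m j
  proof (induction j)
    case 0 show ?case by (simp add: l2_norm_def)
  next
    case (Suc j)
    have "l2_norm \<Omega> (\<lambda>x. F (m + Suc j) x - F m x) \<le>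
        l2_norm \<Omega> (\<lambda>x. F (m + Suc j) x - F (m + j) x) + l2_norm \<Omega> (\<lambda>x. F (m + j) x - F m x)"
      by (rule l2_norm_triangle_diff[OF F F F])
    then show ?case using Suc le[of "m + j"] by (simp add: algebra_simps power_add)
  qed
  have geom: "(\<Sum>i<j. q ^ i) \<le> 1 / (1 - q)" for j
    using q by (simp add: sum_gp_strict divide_right_mono)
  have bound: "l2_norm \<Omega> (\<lambda>x. F (m + j) x - F m x) \<le> D / (1 - q) * q ^ m" for m j
  proof -
    have "D * q ^ m * (\<Sum>i<j. q ^ i) \<le> D * q ^ m * (1 / (1 - q))"
      using q by (intro mult_left_mono geom) (auto simp: D_def)
    then show ?thesis using le'[of m j] by (simp add: mult_ac)
  qed
  fix e :: real assume "e > 0"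
  have "(\<lambda>m. D / (1 - q) * q ^ m) \<longlonglongrightarrow> 0"
    using q by (intro tendsto_mult_right_zero LIMSEQ_realpow_zero)
  then have "\<forall>\<^sub>F m in sequentially. D / (1 - q) * q ^ m < e"
    using \<open>e > 0\<close> by (rule order_tendstoD)
  then obtain N where N: "\<And>m. m \<ge> N \<Longrightarrow> D / (1 - q) * q ^ m < e" by (auto simp: eventually_sequentially)
  have 1: "l2_norm \<Omega> (\<lambda>x. F m x - F n x) < e" if "n \<ge> N" "m \<ge> n" for m n
    using bound[of n "m - n"] N[OF that(1)] that(2) by simp
  have "l2_norm \<Omega> (\<lambda>x. F m x - F n x) < e" if "n \<ge> N" "m \<ge> N" for m n
    using 1[of n m] 1[of m n] that l2_norm_minus_commute[of \<Omega> "F m" "F n"] by (cases "m \<ge> n") auto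
  then show "\<exists>N. \<forall>m\<ge>N. \<forall>n\<ge>N. l2_norm \<Omega> (\<lambda>x. F m x - F n x) < e" by blast
qed

text \<open>With P = W' - W the equation for W' reads W-solution of the right-hand side k - P f. By
  \<open>est\<close>, applied to differences, this fixed-point map contracts with factor b/c <
  1.\<close>

lemma weak_solution_perturbation:
  assumes solv: "\<And>k. k \<in> L2 \<Omega> \<Longrightarrow> \<exists>f. weak_solution h W k f"
    and est: "\<And>k f. k \<in> L2 \<Omega> \<Longrightarrow> weak_solution h W k f \<Longrightarrow> c * l2_norm \<Omega> f \<le> l2_norm \<Omega> k"
    and W: "bounded_potential W" "bounded_potential W'"
    and b: "\<And>x. x \<in> \<Omega> \<Longrightarrow> cmod (W' x - W x) \<le> b" "0 \<le> b" "b < c"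
    and k: "k \<in> L2 \<Omega>"
  shows "\<exists>f. weak_solution h W' k f"
proof -
  define P where "P x = W' x - W x" for x
  have P_meas: "P \<in> borel_measurable (lebesgue_on \<Omega>)"
    using W by (auto simp: P_def[abs_def] bounded_potential_def)
  have P_bound: "cmod (P x) \<le> b" if "x \<in> \<Omega>" for x using b(1)[OF that] by (simp add: P_def)
  have P_L2: "(\<lambda>x. P x * f x) \<in> L2 \<Omega>" if "f \<in> L2 \<Omega>" for f
    using L2_mult_bounded[OF that P_meas P_bound] .
  have P_le: "l2_norm \<Omega> (\<lambda>x. P x * f x) \<le> b * l2_norm \<Omega> f" if "f \<in> L2 \<Omega>" for f
    using l2_norm_mult_le[OF that P_meas P_bound b(2)] .
  obtain R where R: "\<And>k. k \<in> L2 \<Omega> \<Longrightarrow> weak_solution h W k (R k)" using solv by metis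
  define S where "S f = R (\<lambda>x. k x - P x * f x)" for f
  have rhs: "(\<lambda>x. k x - P x * f x) \<in> L2 \<Omega>" if "f \<in> L2 \<Omega>" for f
    using that k by (intro L2_diff P_L2)
  have S: "weak_solution h W (\<lambda>x. k x - P x * f x) (S f)" if "f \<in> L2 \<Omega>" for f
    unfolding S_def using R[OF rhs[OF that]] .
  have S_L2: "S f \<in> L2 \<Omega>" if "f \<in> L2 \<Omega>" for f using weak_solution_L2[OF S[OF that]] .
  define q where "q = b / c"
  have q: "0 \<le> q" "q < 1" using b by (auto simp: q_def)
  have contr: "l2_norm \<Omega> (\<lambda>x. S f x - S f' x) \<le> q * l2_norm \<Omega> (\<lambda>x. f x - f' x)"
    if f: "f \<in> L2 \<Omega>" "f' \<in> L2 \<Omega>" for f f'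
  proof -
    have "c * l2_norm \<Omega> (\<lambda>x. S f x - S f' x) \<le> l2_norm \<Omega> (\<lambda>x. (k x - P x * f x) - (k x - P x * f' x))"
      using est[OF L2_diff[OF rhs rhs] weak_solution_diff[OF S S W(1) rhs rhs]] f by blast
    also have "(\<lambda>x. (k x - P x * f x) - (k x - P x * f' x)) = (\<lambda>x. P x * (f' x - f x))"
      by (simp add: algebra_simps)
    also have "l2_norm \<Omega> (\<lambda>x. P x * (f' x - f x)) \<le> b * l2_norm \<Omega> (\<lambda>x. f x - f' x)"
      using P_le[OF L2_diff[OF f(2,1)]] l2_norm_minus_commute[of \<Omega> f f'] by simp
    finally show ?thesis using b by (simp add: q_def field_simps)
  qed
  define F where "F n = (S ^^ n) (\<lambda>x. 0)" for n
  have F_Suc: "F (Suc n) = S (F n)" for n by (simp add: F_def)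
  have F: "F n \<in> L2 \<Omega>" for n by (induction n) (auto simp: F_def L2_zero S_L2)
  obtain G where G: "G \<in> L2 \<Omega>" "(\<lambda>n. l2_norm \<Omega> (\<lambda>x. F n x - G x)) \<longlonglongrightarrow> 0"
  proof (rule L2_contraction_limit[OF F q])
    show "l2_norm \<Omega> (\<lambda>x. F (Suc (Suc n)) x - F (Suc n) x) \<le> q * l2_norm \<Omega> (\<lambda>x. F (Suc n) x - F n x)" for n
      unfolding F_Suc[of "Suc n"] using contr[OF F F, of "Suc n" n] by (simp add: F_Suc)
  qed
  note SG = S_L2[OF G(1)]
  have "l2_norm \<Omega> (\<lambda>x. S G x - G x) \<le> q * l2_norm \<Omega> (\<lambda>x. F n x - G x) + l2_norm \<Omega> (\<lambda>x. F (Suc n) x - G x)" for n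
    using l2_norm_triangle_diff[OF SG F[of "Suc n"] G(1)] contr[OF F[of n] G(1)]
      l2_norm_minus_commute[of \<Omega> "S G" "F (Suc n)"] by (simp add: F_Suc)
  moreover have "(\<lambda>n. q * l2_norm \<Omega> (\<lambda>x. F n x - G x) + l2_norm \<Omega> (\<lambda>x. F (Suc n) x - G x)) \<longlonglongrightarrow> q * 0 + 0"
    by (intro tendsto_intros G LIMSEQ_Suc[OF G(2)])
  ultimately have "l2_norm \<Omega> (\<lambda>x. S G x - G x) \<le> q * 0 + 0"
    by (intro LIMSEQ_le_const) auto
  then have "l2_norm \<Omega> (\<lambda>x. S G x - G x) = 0" using l2_norm_nonneg by (simp add: order_antisym)
  \<comment> \<open>The limit \<open>G\<close> is a fixed point only almost everywhere.
    \<open>S G\<close> is the representative to use: as a solution it lies in \<open>W12_0\<close>,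
    and P G may be exchanged for P (S G) under the integral.\<close>
  then have ae: "ae_eq \<Omega> (S G) G" using l2_norm_diff_eq_0_iff[OF SG G(1)] by simp
  then have aeP: "ae_eq \<Omega> (\<lambda>x. P x * S G x) (\<lambda>x. P x * G x)" by (auto simp: ae_eq_def elim: AE_mp)
  have "weak_solution h W' k (S G)"
    unfolding weak_solution_def
  proof (intro conjI ballI)
    show "S G \<in> W12_0 \<Omega>" using S[OF G(1)] by (simp add: weak_solution_def)
    fix u assume u: "u \<in> W12_0 \<Omega>"
    note uL2 = W12_0_L2[OF u]
    have "l2_inner \<Omega> (\<lambda>x. W' x * S G x) u = l2_inner \<Omega> (\<lambda>x. W x * S G x) u + l2_inner \<Omega> (\<lambda>x. P x * S G x) u"
      using l2_inner_add_left[OF L2_mult_potential[OF W(1) SG] P_L2[OF SG] uL2] by (simp add: P_def algebra_simps)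
    also have "l2_inner \<Omega> (\<lambda>x. P x * S G x) u = l2_inner \<Omega> (\<lambda>x. P x * G x) u"
      using aeP SG G uL2 by (intro l2_inner_cong P_L2) auto
    finally have "l2_inner \<Omega> (\<lambda>x. W' x * S G x) u = l2_inner \<Omega> (\<lambda>x. W x * S G x) u + l2_inner \<Omega> (\<lambda>x. P x * G x) u" .
    moreover have "of_real (h\<^sup>2) * dirichlet_form \<Omega> (S G) u + l2_inner \<Omega> (\<lambda>x. W x * S G x) u
        = l2_inner \<Omega> k u - l2_inner \<Omega> (\<lambda>x. P x * G x) u"
      using S[OF G(1)] u l2_inner_diff_left[OF k P_L2[OF G(1)] uL2] by (simp add: weak_solution_def)
    ultimately show "of_real (h\<^sup>2) * dirichlet_form \<Omega> (S G) u + l2_inner \<Omega> (\<lambda>x. W' x * S G x) u = l2_inner \<Omega> k u"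
      by (simp add: algebra_simps)
  qed
  then show ?thesis by blast
qed

text \<open>The multiplier estimate: testing the equation with \<open>m f\<close> instead of \<open>f\<close> rotates the potential at
  each point separately, and the price is the commutator term \<open>h\<^sup>2 \<langle>\<nabla>f, f \<nabla>m\<rangle> = O(h)\<close>.\<close>

lemma weak_solution_estimate:
  assumes sol: "weak_solution h W k f" and k: "k \<in> L2 \<Omega>" and h: "h \<ge> 0"
    and W: "bounded_potential W" "\<And>x. x \<in> \<Omega> \<Longrightarrow> - M \<le> Re (W x)" "M \<ge> 0"
    and m: "smooth m" "\<And>x. x \<in> \<Omega> \<Longrightarrow> cmod (m x) \<le> 1" "\<And>x. x \<in> \<Omega> \<Longrightarrow> 0 \<le> Re (m x)"
    and \<delta>: "\<And>x. x \<in> \<Omega> \<Longrightarrow> \<delta> \<le> Re (W x * cnj (m x))"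
    and G: "\<And>i x. x \<in> \<Omega> \<Longrightarrow> cmod (pderiv_at i m x) \<le> G" "G \<ge> 0"
  shows "(\<delta> - h * G * CARD('n) * (M + 1)) * l2_norm \<Omega> f \<le> (1 + h * G * CARD('n)) * l2_norm \<Omega> k"
proof -
  obtain g where g: "dirichlet_gradient f g"
    using sol W12_0_dirichlet_gradient by (auto simp: weak_solution_def)
  note L2 = dirichlet_gradient_L2[OF g]
  note mg = dirichlet_gradient_mult[OF g m(1)]
  define a where "a = l2_norm \<Omega> f"
  define b where "b = l2_norm \<Omega> k"
  have ab: "a \<ge> 0" "b \<ge> 0" by (auto simp: a_def b_def)
  have eq: "of_real (h\<^sup>2) * (\<Sum>i\<in>UNIV. l2_inner \<Omega> (g i) (v i)) + l2_inner \<Omega> (\<lambda>x. W x * f x) u = l2_inner \<Omega> k u"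
    if "dirichlet_gradient u v" for u v
    using sol dirichlet_gradient_W12_0[OF that] by (simp add: weak_solution_def flip: dirichlet_form_eq[OF g that])
  \<comment> \<open>Testing with \<open>f\<close> itself. Only a lower bound of Re W enters, so the
    constants survive shifts by s \<ge> 0. The crude square on the right gives a bound linear in
    \<open>a\<close> and \<open>b\<close>, which can be absorbed later.\<close>
  have grad: "h * l2_norm \<Omega> (g i) \<le> b + (M + 1) * a" for i
  proof (rule power2_le_imp_le)
    have "- M * a\<^sup>2 \<le> Re (l2_inner \<Omega> (\<lambda>x. W x * f x) f)"
      using Re_l2_inner_mult_ge[of f \<Omega> W "\<lambda>_. 1" "- M"] L2 L2_mult_potential[OF W(1)] W(2) by (simp add: a_def)
    moreover have "Re (l2_inner \<Omega> k f) \<le> b * a"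
      using l2_Cauchy_Schwarz[OF k L2(1)] complex_Re_le_cmod order_trans unfolding a_def b_def by blast
    moreover have "h\<^sup>2 * (\<Sum>i\<in>UNIV. (l2_norm \<Omega> (g i))\<^sup>2) + Re (l2_inner \<Omega> (\<lambda>x. W x * f x) f) = Re (l2_inner \<Omega> k f)"
      using arg_cong[OF eq[OF g], of Re] by (simp add: l2_inner_self L2)
    moreover have "h\<^sup>2 * (l2_norm \<Omega> (g i))\<^sup>2 \<le> h\<^sup>2 * (\<Sum>i\<in>UNIV. (l2_norm \<Omega> (g i))\<^sup>2)"
      by (intro mult_left_mono member_le_sum) auto
    ultimately have "(h * l2_norm \<Omega> (g i))\<^sup>2 \<le> b * a + M * a\<^sup>2" by (simp add: power_mult_distrib)
    also have "\<dots> \<le> (b + (M + 1) * a)\<^sup>2"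
    proof -
      have "0 \<le> b\<^sup>2 + b * a + 2 * (M * (a * b)) + (M\<^sup>2 + M + 1) * a\<^sup>2"
        using ab W(3) by (intro add_nonneg_nonneg mult_nonneg_nonneg) auto
      then show ?thesis by (simp add: power2_eq_square algebra_simps)
    qed
    finally show "(h * l2_norm \<Omega> (g i))\<^sup>2 \<le> (b + (M + 1) * a)\<^sup>2" .
  qed (use ab W(3) in simp)
  have mf: "l2_norm \<Omega> (\<lambda>x. m x * f x) \<le> a"
    using l2_norm_mult_le[OF L2(1) measurable_smooth[OF m(1)] m(2)] by (simp add: a_def)
  have 1: "\<delta> * a\<^sup>2 \<le> Re (l2_inner \<Omega> (\<lambda>x. W x * f x) (\<lambda>x. m x * f x))"
    using Re_l2_inner_mult_ge[OF L2(1) L2_mult_potential[OF W(1) L2(1)] L2_mult_smooth[OF m(1) L2(1)] \<delta>] by (simp add: a_def)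
  have 2: "Re (l2_inner \<Omega> k (\<lambda>x. m x * f x)) \<le> b * a"
  proof -
    have "Re (l2_inner \<Omega> k (\<lambda>x. m x * f x)) \<le> b * l2_norm \<Omega> (\<lambda>x. m x * f x)"
      using l2_Cauchy_Schwarz[OF k L2_mult_smooth[OF m(1) L2(1)]] complex_Re_le_cmod order_trans unfolding b_def by blast
    also have "\<dots> \<le> b * a" using mf ab by (intro mult_left_mono)
    finally show ?thesis .
  qed
  \<comment> \<open>Re m \<ge> 0 allows the term with m times the gradient to be dropped. In the
    commutator term one factor \<open>h\<close> is spent on \<open>grad\<close>; the other remains
    as the small parameter.\<close>
  have 3: "- (h * G * (b + (M + 1) * a) * a) \<le> h\<^sup>2 * Re (l2_inner \<Omega> (g i) (\<lambda>x. m x * g i x + pderiv_at i m x * f x))" for i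
  proof -
    note L2m = L2_mult_smooth[OF m(1) L2(2)] L2_mult_smooth[OF smooth_pderiv_at[OF m(1)] L2(1)]
    have "0 \<le> Re (l2_inner \<Omega> (g i) (\<lambda>x. m x * g i x))"
      using Re_l2_inner_mult_ge[of "g i" \<Omega> "\<lambda>_. 1" m 0] L2 L2m m(3) by simp
    moreover have "- (l2_norm \<Omega> (g i) * (G * a)) \<le> Re (l2_inner \<Omega> (g i) (\<lambda>x. pderiv_at i m x * f x))"
    proof -
      have "cmod (l2_inner \<Omega> (g i) (\<lambda>x. pderiv_at i m x * f x)) \<le> l2_norm \<Omega> (g i) * l2_norm \<Omega> (\<lambda>x. pderiv_at i m x * f x)"
        using L2 L2m by (intro l2_Cauchy_Schwarz)
      also have "\<dots> \<le> l2_norm \<Omega> (g i) * (G * a)"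
        unfolding a_def using L2 G measurable_smooth[OF smooth_pderiv_at[OF m(1)]]
        by (intro mult_left_mono l2_norm_mult_le) auto
      finally show ?thesis using abs_Re_le_cmod[of "l2_inner \<Omega> (g i) (\<lambda>x. pderiv_at i m x * f x)"] by linarith
    qed
    ultimately have "- (l2_norm \<Omega> (g i) * (G * a)) \<le> Re (l2_inner \<Omega> (g i) (\<lambda>x. m x * g i x + pderiv_at i m x * f x))"
      using L2 L2m by (simp add: l2_inner_add_right)
    from mult_left_mono[OF this, of "h\<^sup>2"]
    have "- (h * G * a * (h * l2_norm \<Omega> (g i))) \<le> h\<^sup>2 * Re (l2_inner \<Omega> (g i) (\<lambda>x. m x * g i x + pderiv_at i m x * f x))"
      by (simp add: power2_eq_square mult_ac)
    moreover have "h * G * a * (h * l2_norm \<Omega> (g i)) \<le> h * G * a * (b + (M + 1) * a)"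
      using h G ab by (intro mult_left_mono grad) auto
    ultimately show ?thesis by (simp add: mult_ac)
  qed
  have "real CARD('n) * (- (h * G * (b + (M + 1) * a) * a)) \<le>
     (\<Sum>i\<in>UNIV. h\<^sup>2 * Re (l2_inner \<Omega> (g i) (\<lambda>x. m x * g i x + pderiv_at i m x * f x)))"
    using sum_mono[OF 3, of UNIV] by simp
  moreover have "(\<Sum>i\<in>UNIV. h\<^sup>2 * Re (l2_inner \<Omega> (g i) (\<lambda>x. m x * g i x + pderiv_at i m x * f x))) +
     Re (l2_inner \<Omega> (\<lambda>x. W x * f x) (\<lambda>x. m x * f x)) = Re (l2_inner \<Omega> k (\<lambda>x. m x * f x))"
    using arg_cong[OF eq[OF mg], of Re] by (simp add: sum_distrib_left)
  \<comment> \<open>One factor \<open>a\<close> is divided out; for a = 0 the claim is the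
    nonnegativity of its right side.\<close>
  ultimately have "a * ((\<delta> - h * G * CARD('n) * (M + 1)) * a) \<le> a * ((1 + h * G * CARD('n)) * b)"
    using 1 2 by (simp add: algebra_simps power2_eq_square)
  moreover have "0 \<le> (1 + h * G * CARD('n)) * b" using h G ab by simp
  ultimately show ?thesis
    using ab(1) unfolding a_def[symmetric] b_def[symmetric] by (cases "a = 0") auto
qed

end

section \<open>The resolvent\<close>

text \<open>The sum of a compact set and a closed one is closed. Closedness turns
  \<open>\<mu> \<notin> Phi \<Omega> V\<close> into a positive distance.\<close>

lemma closed_Phi:
  assumes "bounded (V ` closure \<Omega>)"
  shows "closed (Phi \<Omega> V)"
proof -
  let ?T = "{z. Im z = 0 \<and> 0 \<le> Re z}"
  have T: "?T = {complex_of_real t |t. 0 \<le> t}"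
    by (auto simp: complex_eq_iff)
  have "closed ?T"
    by (intro closed_Collect_conj closed_Collect_eq closed_Collect_le continuous_intros)
  then have "closed (\<Union>x\<in>closure (V ` closure \<Omega>). \<Union>y\<in>?T. {x + y})"
    using assms by (intro compact_closed_sums) (simp_all add: compact_closure)
  also have "(\<Union>x\<in>closure (V ` closure \<Omega>). \<Union>y\<in>?T. {x + y}) = Phi \<Omega> V"
    unfolding T Phi_def by auto
  finally show ?thesis .
qed

text \<open>With \<open>w = \<mu> - z\<close> and \<open>p\<close> the point of \<open>[0, \<infinity>)\<close> nearest to \<open>w\<close>, the unit vector \<open>(p - w) / |p - w|\<close>
  is a normal to a line separating \<open>w\<close> from \<open>[0, \<infinity>)\<close>.\<close>

definition separating_unit :: "complex \<Rightarrow> complex" where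
  "separating_unit w = sgn (of_real (max (Re w) 0) - w)"

lemma Re_separating_unit: "0 \<le> Re (separating_unit w)"
  by (auto simp: separating_unit_def sgn_eq zero_le_divide_iff max_def)

text \<open>Put p = max (Re w) 0 and v = p - w, so -w = v - p. Either p = 0 or Re v = 0, hence Re (p
  cnj v) = 0 and Re (-w cnj v) = |v|^2; then divide by |v|.\<close>

lemma Re_mult_cnj_separating_unit: "Re (- w * cnj (separating_unit w)) = cmod (of_real (max (Re w) 0) - w)"
proof (cases "of_real (max (Re w) 0) - w = 0")
  case True
  then show ?thesis unfolding separating_unit_def True by simp
next
  case False
  let ?v = "of_real (max (Re w) 0) - w"
  have "Re (- w * cnj ?v) = (cmod ?v)\<^sup>2"
    unfolding cmod_power2 by (auto simp: max_def power2_eq_square algebra_simps)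
  moreover have "Re (- w * cnj (separating_unit w)) = Re (- w * cnj ?v) / cmod ?v"
    unfolding Re_divide_of_real[symmetric] by (simp add: separating_unit_def sgn_eq)
  ultimately show ?thesis using False by (simp add: power2_eq_square)
qed

section \<open>Weak solutions and the resolvent estimate\<close>

context bounded_domain
begin

text \<open>Combines the two nested graphs into one equation. From right to left, -\<Delta>f can
  only be (k - (V - \<mu>) f) / h^2, which is in L^2 because the potential is bounded.\<close>

lemma op_minus_scalar_iff_weak_solution:
  assumes "h > 0" and V: "bounded_potential V"
  shows "(f, k) \<in> op_minus_scalar \<Omega> (schroedinger_op \<Omega> V h) \<mu> \<longleftrightarrow>
    k \<in> L2 \<Omega> \<and> weak_solution h (\<lambda>x. V x - \<mu>) k f" (is "?L \<longleftrightarrow> ?R")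
proof
  assume ?L
  then obtain k' g where k: "k \<in> L2 \<Omega>" "k' \<in> L2 \<Omega>" "ae_eq \<Omega> k (\<lambda>x. k' x - \<mu> * f x)"
    and lap: "(f, g) \<in> neg_dirichlet_laplacian \<Omega>" and k': "ae_eq \<Omega> k' (\<lambda>x. of_real (h\<^sup>2) * g x + V x * f x)"
    by (auto simp: op_minus_scalar_def schroedinger_op_def)
  have f: "f \<in> W12_0 \<Omega>" and g: "g \<in> L2 \<Omega>"
    and form: "\<And>u. u \<in> W12_0 \<Omega> \<Longrightarrow> dirichlet_form \<Omega> f u = l2_inner \<Omega> g u"
    using lap by (auto simp: neg_dirichlet_laplacian_def)
  note fL2 = W12_0_L2[OF f]
  have ae: "ae_eq \<Omega> k (\<lambda>x. of_real (h\<^sup>2) * g x + (V x * f x - \<mu> * f x))"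
    using k(3) k' unfolding ae_eq_def by (auto elim!: AE_mp simp: algebra_simps)
  note L2s = L2_cmult[OF g, of "of_real (h\<^sup>2)"] L2_diff[OF L2_mult_potential[OF V fL2] L2_cmult[OF fL2, of \<mu>]]
  have "of_real (h\<^sup>2) * dirichlet_form \<Omega> f u + l2_inner \<Omega> (\<lambda>x. (V x - \<mu>) * f x) u = l2_inner \<Omega> k u"
    if u: "u \<in> W12_0 \<Omega>" for u
  proof -
    note uL2 = W12_0_L2[OF u]
    have "l2_inner \<Omega> k u = l2_inner \<Omega> (\<lambda>x. of_real (h\<^sup>2) * g x + (V x * f x - \<mu> * f x)) u"
      using ae k L2s uL2 by (intro l2_inner_cong L2_add) auto
    also have "\<dots> = of_real (h\<^sup>2) * l2_inner \<Omega> g u + l2_inner \<Omega> (\<lambda>x. V x * f x - \<mu> * f x) u"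
      by (simp only: l2_inner_add_left[OF L2s uL2] l2_inner_cmult_left)
    finally show ?thesis by (simp add: form[OF u] left_diff_distrib)
  qed
  then show ?R using k(1) f by (simp add: weak_solution_def)
next
  assume R: ?R
  then have k: "k \<in> L2 \<Omega>" and f: "f \<in> W12_0 \<Omega>" by (auto simp: weak_solution_def)
  note fL2 = W12_0_L2[OF f]
  have VfL2: "(\<lambda>x. (V x - \<mu>) * f x) \<in> L2 \<Omega>"
    using L2_diff[OF L2_mult_potential[OF V fL2] L2_cmult[OF fL2, of \<mu>]] by (simp add: left_diff_distrib)
  define g where "g x = of_real (inverse (h\<^sup>2)) * (k x - (V x - \<mu>) * f x)" for x
  have g: "g \<in> L2 \<Omega>" unfolding g_def by (intro L2_cmult L2_diff k VfL2)
  have h2g: "of_real (h\<^sup>2) * g x = k x - (V x - \<mu>) * f x" for x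
    using assms(1) by (simp add: g_def)
  have "dirichlet_form \<Omega> f u = l2_inner \<Omega> g u" if u: "u \<in> W12_0 \<Omega>" for u
  proof -
    note uL2 = W12_0_L2[OF u]
    have "of_real (h\<^sup>2) * dirichlet_form \<Omega> f u + l2_inner \<Omega> (\<lambda>x. (V x - \<mu>) * f x) u = l2_inner \<Omega> k u"
      using R u by (auto simp: weak_solution_def)
    moreover have "of_real (h\<^sup>2) * l2_inner \<Omega> g u = l2_inner \<Omega> k u - l2_inner \<Omega> (\<lambda>x. (V x - \<mu>) * f x) u"
      unfolding l2_inner_cmult_left[symmetric] h2g using l2_inner_diff_left[OF k VfL2 uL2] .
    ultimately have "of_real (h\<^sup>2) * dirichlet_form \<Omega> f u = of_real (h\<^sup>2) * l2_inner \<Omega> g u"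
      by (metis add_diff_cancel_right')
    then show ?thesis using assms(1) by simp
  qed
  then have lap: "(f, g) \<in> neg_dirichlet_laplacian \<Omega>" using f g by (simp add: neg_dirichlet_laplacian_def)
  let ?k = "\<lambda>x. of_real (h\<^sup>2) * g x + V x * f x"
  have "?k \<in> L2 \<Omega>" by (intro L2_add L2_cmult g L2_mult_potential V fL2)
  then have "(f, ?k) \<in> schroedinger_op \<Omega> V h" using lap by (auto simp: schroedinger_op_def)
  moreover have "ae_eq \<Omega> k (\<lambda>x. ?k x - \<mu> * f x)" unfolding h2g by (simp add: algebra_simps)
  ultimately show ?L using k by (auto simp: op_minus_scalar_def)
qed

lemma continuous_bounded_potential:
  assumes "continuous_on (closure \<Omega>) V"
  shows "bounded_potential V"
proof -
  have "V \<in> borel_measurable (lebesgue_on \<Omega>)"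
    using assms closure_subset by (intro continuous_imp_measurable_on_sets_lebesgue) (auto intro: continuous_on_subset)
  moreover have "bounded (V ` closure \<Omega>)"
    using assms bounded_domain by (intro compact_imp_bounded compact_continuous_image) (auto simp: compact_closure)
  then obtain C where "\<forall>x\<in>closure \<Omega>. cmod (V x) \<le> C" by (auto simp: bounded_iff)
  then have "\<forall>x\<in>\<Omega>. cmod (V x) \<le> C" using closure_subset by blast
  ultimately show ?thesis by (auto simp: bounded_potential_def)
qed

text \<open>The bounds |m| \<le> 1 and Re m \<ge> 0 must hold exactly: a negative Re m would be
  amplified without limit by large shifts s. Only the lower bound \<open>d\<close> may be
  approximate, so the polynomial is corrected at its expense.\<close>

lemma exists_smooth_multiplier:
  assumes V: "continuous_on (closure \<Omega>) V" and \<mu>: "\<And>z. z \<in> Phi \<Omega> V \<Longrightarrow> d \<le> dist \<mu> z" and "d > 0" "\<epsilon> > 0"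
  obtains m where "smooth m" "\<forall>x\<in>\<Omega>. cmod (m x) \<le> 1" "\<forall>x\<in>\<Omega>. 0 \<le> Re (m x)"
    "\<forall>x\<in>\<Omega>. d - \<epsilon> \<le> Re ((V x - \<mu>) * cnj (m x))"
proof -
  have comp: "compact (closure \<Omega>)" using bounded_domain by (simp add: compact_closure)
  define e where "e x = separating_unit (\<mu> - V x)" for x
  have "continuous_on (closure \<Omega>) (\<lambda>x. V x - \<mu>)" using V by (intro continuous_intros)
  from continuous_bounded_potential[OF this] obtain C where "\<forall>x\<in>\<Omega>. cmod (V x - \<mu>) \<le> C"
    by (auto simp: bounded_potential_def)
  then obtain M where M: "\<And>x. x \<in> \<Omega> \<Longrightarrow> cmod (V x - \<mu>) \<le> M" "M \<ge> 0"
    by (metis max.cobounded2 max.coboundedI1)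
  have far: "d \<le> cmod (of_real (max (Re (\<mu> - V x)) 0) - (\<mu> - V x))" if "x \<in> closure \<Omega>" for x
  proof -
    have "V x \<in> closure (V ` closure \<Omega>)" using that closure_subset[of "V ` closure \<Omega>"] by blast
    then have "V x + of_real (max (Re (\<mu> - V x)) 0) \<in> Phi \<Omega> V"
      unfolding Phi_def by (intro CollectI exI conjI refl) auto
    from \<mu>[OF this] show ?thesis by (simp add: dist_norm norm_minus_commute algebra_simps)
  qed
  \<comment> \<open>\<open>sgn\<close> is discontinuous only at 0, and \<open>far\<close> keeps its
    argument at distance at least \<open>d\<close> from there.\<close>
  have cont: "continuous_on (closure \<Omega>) e"
    unfolding e_def separating_unit_def sgn_div_norm
    by (intro continuous_intros V) (use far \<open>d > 0\<close> in force)
  \<comment> \<open>The correction needs (d - \<epsilon>)(1 + 2\<eta>) \<le> d - 2\<eta>M; this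
    follows from 2\<eta>(M + d) = \<epsilon>.\<close>
  define \<eta> where "\<eta> = \<epsilon> / (2 * (M + d))"
  have \<eta>: "\<eta> > 0" using assms M by (simp add: \<eta>_def)
  obtain g where g: "polynomial_function g" "\<And>x. x \<in> closure \<Omega> \<Longrightarrow> cmod (e x - g x) < \<eta>"
    using Stone_Weierstrass_polynomial_function[OF comp cont \<eta>] by blast
  have "real_polynomial_function (\<lambda>x. Re (g x))" "real_polynomial_function (\<lambda>x. Im (g x))"
    using g(1) bounded_linear_Re bounded_linear_Im by (auto simp: polynomial_function_def o_def)
  then have "smooth (\<lambda>x. of_real (Re (g x)) + \<i> * of_real (Im (g x)))"
    by (intro smooth_add smooth_mult smooth_const smooth_of_real_polynomial_function)
  then have sg: "smooth g" by (simp flip: complex_eq)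
  \<comment> \<open>Adding \<eta> restores a nonnegative real part after an approximation error
    below \<eta>; dividing by 1 + 2\<eta> restores modulus at most 1.\<close>
  define m where "m x = of_real (1 / (1 + 2 * \<eta>)) * (g x + of_real \<eta>)" for x
  show ?thesis
  proof (rule that)
    show "smooth m" unfolding m_def by (intro smooth_mult smooth_add smooth_const sg)
    have e1: "cmod (e x) \<le> 1" for x by (simp add: e_def separating_unit_def norm_sgn)
    have gx: "cmod (e x - g x) < \<eta>" if "x \<in> \<Omega>" for x using g(2) that closure_subset by blast
    show "\<forall>x\<in>\<Omega>. cmod (m x) \<le> 1"
    proof
      fix x assume x: "x \<in> \<Omega>"
      have "cmod (g x + of_real \<eta>) \<le> cmod (e x) + cmod (e x - g x) + cmod (of_real \<eta>)"
        by (smt (verit) norm_triangle_ineq norm_triangle_ineq3 norm_minus_commute)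
      also have "\<dots> \<le> 1 + 2 * \<eta>" using e1[of x] gx[OF x] \<eta> by simp
      finally show "cmod (m x) \<le> 1" using \<eta> unfolding m_def norm_mult norm_of_real by (simp add: field_simps)
    qed
    show "\<forall>x\<in>\<Omega>. 0 \<le> Re (m x)"
    proof
      fix x assume x: "x \<in> \<Omega>"
      have "Re (e x - g x) < \<eta>" using gx[OF x] complex_Re_le_cmod[of "e x - g x"] by linarith
      then have "0 \<le> Re (g x + of_real \<eta>)" using Re_separating_unit[of "\<mu> - V x"] by (simp add: e_def)
      then show "0 \<le> Re (m x)" using \<eta> unfolding m_def by (simp only: Re_complex_of_real times_complex.sel) simp
    qed
    show "\<forall>x\<in>\<Omega>. d - \<epsilon> \<le> Re ((V x - \<mu>) * cnj (m x))"
    proof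
      fix x assume x: "x \<in> \<Omega>"
      then have "x \<in> closure \<Omega>" using closure_subset by blast
      let ?W = "V x - \<mu>"
      have 1: "d \<le> Re (?W * cnj (e x))"
        using Re_mult_cnj_separating_unit[of "\<mu> - V x"] far[OF \<open>x \<in> closure \<Omega>\<close>] by (simp only: e_def minus_diff_eq)
      have "cmod (?W * cnj (g x + of_real \<eta> - e x)) \<le> M * (2 * \<eta>)"
      proof -
        have "cmod (g x + of_real \<eta> - e x) \<le> cmod (e x - g x) + cmod (of_real \<eta>)"
          by (smt (verit) norm_triangle_ineq norm_minus_commute add_diff_eq add.commute)
        also have "\<dots> \<le> 2 * \<eta>" using gx[OF x] \<eta> by simp
        finally show ?thesis
          using M(1)[OF x] M(2) unfolding norm_mult complex_mod_cnj by (intro mult_mono) auto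
      qed
      then have "- (M * (2 * \<eta>)) \<le> Re (?W * cnj (g x + of_real \<eta> - e x))"
        using abs_Re_le_cmod[of "?W * cnj (g x + of_real \<eta> - e x)"] by linarith
      moreover have "Re (?W * cnj (g x + of_real \<eta>)) = Re (?W * cnj (e x)) + Re (?W * cnj (g x + of_real \<eta> - e x))"
        by (simp add: algebra_simps)
      ultimately have 2: "d - 2 * \<eta> * M \<le> Re (?W * cnj (g x + of_real \<eta>))"
        using 1 mult.commute[of M "2 * \<eta>"] by linarith
      have "(d - \<epsilon>) * (1 + 2 * \<eta>) \<le> d - 2 * \<eta> * M"
      proof -
        have "2 * (M + d) \<noteq> 0" using M \<open>d > 0\<close> by simp
        from nonzero_eq_divide_eq[OF this, THEN iffD1, OF \<eta>_def] have "\<eta> * (2 * (M + d)) = \<epsilon>" .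
        moreover have "0 \<le> \<epsilon> * \<eta>" using \<eta> \<open>\<epsilon> > 0\<close> by simp
        ultimately show ?thesis by (simp add: algebra_simps)
      qed
      then have "d - \<epsilon> \<le> Re (?W * cnj (g x + of_real \<eta>)) / (1 + 2 * \<eta>)"
        using 2 \<eta> by (simp add: pos_le_divide_eq)
      also have "\<dots> = Re (of_real (1 / (1 + 2 * \<eta>)) * (?W * cnj (g x + of_real \<eta>)))"
        by (simp only: Re_complex_of_real times_complex.sel Im_complex_of_real) simp
      also have "\<dots> = Re (?W * cnj (m x))"
        by (simp add: m_def mult_ac)
      finally show "d - \<epsilon> \<le> Re (?W * cnj (m x))" .
    qed
  qed
qed

text \<open>The method of continuity: the constant \<open>c\<close> in \<open>est\<close> does not
  depend on s, so each perturbation step can have the same length and finitely many lead from a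
  large shift to s = 0.\<close>

lemma weak_solution_exists:
  assumes "h > 0" "c > 0" and W: "bounded_potential W" and k: "k \<in> L2 \<Omega>"
    and est: "\<And>s k f. s \<ge> 0 \<Longrightarrow> k \<in> L2 \<Omega> \<Longrightarrow> weak_solution h (\<lambda>x. W x + of_real s) k f \<Longrightarrow> c * l2_norm \<Omega> f \<le> l2_norm \<Omega> k"
  shows "\<exists>f. weak_solution h W k f"
proof -
  have bp: "bounded_potential (\<lambda>x. W x + of_real s)" for s
  proof -
    obtain C where C: "W \<in> borel_measurable (lebesgue_on \<Omega>)" "\<forall>x\<in>\<Omega>. cmod (W x) \<le> C" using W by (auto simp: bounded_potential_def)
    have "\<forall>x\<in>\<Omega>. cmod (W x + of_real s) \<le> C + \<bar>s\<bar>"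
      using C(2) by (auto intro: norm_triangle_mono)
    then show ?thesis using C(1) by (auto simp: bounded_potential_def)
  qed
  have bc: "bounded_potential (\<lambda>x. of_real s)" for s
    by (auto simp: bounded_potential_def)
  obtain C where "\<forall>x\<in>\<Omega>. cmod (W x) \<le> C" using W by (auto simp: bounded_potential_def)
  then obtain M where M: "\<And>x. x \<in> \<Omega> \<Longrightarrow> cmod (W x) \<le> M" "M \<ge> 0"
    by (metis max.cobounded2 max.coboundedI1)
  \<comment> \<open>Starts at M + 1 and descends by c/2, which is below the admissible
    \<open>c\<close>, until it is cut off at 0.\<close>
  define S where "S n = max 0 (M + 1 - real n * (c / 2))" for n
  have "k \<in> L2 \<Omega> \<Longrightarrow> \<exists>f. weak_solution h (\<lambda>x. W x + of_real (S n)) k f" for k n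
  proof (induction n arbitrary: k)
    case 0
    show ?case
    \<comment> \<open>At the start \<open>W\<close> itself is the perturbation of the constant M +
      1. That constant has lower bound M + 1, by the multiplier 1, and this exceeds the bound
      \<open>M\<close> on |W|.\<close>
    proof (rule weak_solution_perturbation[where W="\<lambda>_. of_real (M + 1)" and c="M + 1" and b=M])
      show "\<exists>f. weak_solution h (\<lambda>_. of_real (M + 1)) k f" if "k \<in> L2 \<Omega>" for k
        using weak_solution_positive_constant[of h "M + 1" k] assms(1) M(2) that by simp
      show "(M + 1) * l2_norm \<Omega> f \<le> l2_norm \<Omega> k" if "k \<in> L2 \<Omega>" "weak_solution h (\<lambda>_. of_real (M + 1)) k f" for k f
        using weak_solution_estimate[OF that(2,1), where M=0 and m="\<lambda>_. 1" and \<delta>="M+1" and G=0]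
          assms(1) bc[of "M + 1"] M(2) smooth_const[of 1] by simp
    qed (use bp[of "M + 1"] bc[of "M + 1"] M 0 in \<open>simp_all add: S_def\<close>)
  next
    case (Suc n)
    show ?case
    proof (rule weak_solution_perturbation[where W="\<lambda>x. W x + of_real (S n)" and c=c and b="c / 2"])
      show "\<exists>f. weak_solution h (\<lambda>x. W x + of_real (S n)) k f" if "k \<in> L2 \<Omega>" for k
        using Suc.IH[OF that] .
      show "c * l2_norm \<Omega> f \<le> l2_norm \<Omega> k" if "k \<in> L2 \<Omega>" "weak_solution h (\<lambda>x. W x + of_real (S n)) k f" for k f
        using est[OF _ that] by (simp add: S_def)
      have "\<bar>S (Suc n) - S n\<bar> \<le> c / 2" using assms(2) by (auto simp: S_def max_def algebra_simps)
      then show "cmod (W x + of_real (S (Suc n)) - (W x + of_real (S n))) \<le> c / 2" for x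
        by (simp flip: of_real_diff)
    qed (use bp Suc.prems assms(2) in auto)
  qed
  moreover have "\<exists>n. M + 1 < real n * (c / 2)"
    using reals_Archimedean3[of "c / 2"] assms(2) by (simp only: half_gt_zero)
  then obtain n where "M + 1 < real n * (c / 2)" ..
  then have "S n = 0" by (simp add: S_def)
  ultimately show ?thesis using k by (metis (no_types, lifting) add.right_neutral ext of_real_0)
qed

text \<open>The gap d - c is split in two: one half covers the loss in the smooth multiplier, the
  other absorbs the O(h) terms.\<close>

lemma eventually_resolvent_norm_le:
  assumes V: "continuous_on (closure \<Omega>) V" and \<mu>: "\<And>z. z \<in> Phi \<Omega> V \<Longrightarrow> d \<le> dist \<mu> z" and c: "0 < c" "c < d"
  shows "\<forall>\<^sub>F h in at_right 0. resolvent_norm \<Omega> (schroedinger_op \<Omega> V h) \<mu> \<le> ereal (1 / c)"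
proof -
  define \<epsilon> where "\<epsilon> = (d - c) / 2"
  have \<epsilon>: "\<epsilon> > 0" "d - \<epsilon> = c + \<epsilon>" using c by (auto simp: \<epsilon>_def field_simps)
  obtain m where m: "smooth m" "\<forall>x\<in>\<Omega>. cmod (m x) \<le> 1" "\<forall>x\<in>\<Omega>. 0 \<le> Re (m x)"
    "\<forall>x\<in>\<Omega>. d - \<epsilon> \<le> Re ((V x - \<mu>) * cnj (m x))"
    using exists_smooth_multiplier[OF V \<mu> _ \<epsilon>(1)] c by (metis less_trans)
  let ?W = "\<lambda>x. V x - \<mu>"
  have "continuous_on (closure \<Omega>) ?W" using V by (intro continuous_intros)
  then have W: "bounded_potential ?W" by (rule continuous_bounded_potential)
  have Ws: "bounded_potential (\<lambda>x. V x - \<mu> + of_real s)" for s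
    using V by (intro continuous_bounded_potential continuous_intros)
  obtain C where "\<forall>x\<in>\<Omega>. cmod (?W x) \<le> C" using W by (auto simp: bounded_potential_def)
  then obtain M where M: "\<And>x. x \<in> \<Omega> \<Longrightarrow> cmod (?W x) \<le> M" "M \<ge> 0"
    by (metis max.cobounded2 max.coboundedI1)
  have "\<exists>C. \<forall>x\<in>\<Omega>. cmod (pderiv_at i m x) \<le> C" for i
    using smooth_bounded_on_domain[OF smooth_pderiv_at[OF m(1)]] by metis
  then obtain C where C: "\<And>i x. x \<in> \<Omega> \<Longrightarrow> cmod (pderiv_at i m x) \<le> C i" by metis
  define G where "G = (\<Sum>i\<in>UNIV. \<bar>C i\<bar>)"
  have G: "cmod (pderiv_at i m x) \<le> G" if "x \<in> \<Omega>" for i x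
    using C[OF that, of i] member_le_sum[of i UNIV "\<lambda>i. \<bar>C i\<bar>"] by (simp add: G_def)
  have G0: "G \<ge> 0" by (simp add: G_def sum_nonneg)
  \<comment> \<open>With d - \<epsilon> = c + \<epsilon>, the inequality \<open>small\<close>
    amounts to h G N (M + 1 + c) \<le> \<epsilon>, where N is the dimension; the summand 1 makes
    \<open>A\<close> positive even for G = 0.\<close>
  define A where "A = G * CARD('n) * (M + 1 + c) + 1"
  have A: "A > 0" using G0 M(2) c by (simp add: A_def add_nonneg_pos)
  have "\<forall>\<^sub>F h in at_right 0. h < \<epsilon> / A"
    using A \<epsilon> by (intro order_tendstoD[OF tendsto_ident_at]) auto
  moreover have "\<forall>\<^sub>F h in at_right 0. (h::real) > 0" by (rule eventually_at_right_less)
  ultimately show ?thesis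
  proof eventually_elim
    case (elim h)
    have "h * A \<le> \<epsilon>" using elim A by (simp add: field_simps)
    then have small: "c * (1 + h * G * CARD('n)) \<le> (d - \<epsilon>) - h * G * CARD('n) * (M + 1)"
      using elim(2) \<epsilon>(2) by (simp add: A_def algebra_simps)
    have est: "c * l2_norm \<Omega> f \<le> l2_norm \<Omega> k"
      if s: "s \<ge> 0" and k: "k \<in> L2 \<Omega>" and sol: "weak_solution h (\<lambda>x. V x - \<mu> + of_real s) k f" for s k f
    proof -
      have "((d - \<epsilon>) - h * G * CARD('n) * (M + 1)) * l2_norm \<Omega> f \<le> (1 + h * G * CARD('n)) * l2_norm \<Omega> k"
      proof (rule weak_solution_estimate[OF sol k _ Ws _ M(2) m(1)])
        fix x assume x: "x \<in> \<Omega>"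
        show "- M \<le> Re (V x - \<mu> + of_real s)"
          using abs_Re_le_cmod[of "V x - \<mu>"] M(1)[OF x] s by simp
        \<comment> \<open>The shift can only raise the rotated potential, so the estimate is uniform
          in \<open>s\<close>.\<close>
        have "0 \<le> s * Re (m x)" using s m(3) x by simp
        then show "d - \<epsilon> \<le> Re ((V x - \<mu> + of_real s) * cnj (m x))"
          using m(4) x by (fastforce simp: algebra_simps)
      qed (use elim m G G0 in auto)
      moreover have "c * (1 + h * G * CARD('n)) * l2_norm \<Omega> f \<le> ((d - \<epsilon>) - h * G * CARD('n) * (M + 1)) * l2_norm \<Omega> f"
        using small by (intro mult_right_mono) auto
      ultimately have "(1 + h * G * CARD('n)) * (c * l2_norm \<Omega> f) \<le> (1 + h * G * CARD('n)) * l2_norm \<Omega> k"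
        by (simp add: mult_ac)
      moreover have "1 + h * G * CARD('n) > 0" using elim G0 by (simp add: add_pos_nonneg)
      ultimately show ?thesis by (simp only: mult_le_cancel_left_pos)
    qed
    have est0: "c * l2_norm \<Omega> f \<le> l2_norm \<Omega> k" if "k \<in> L2 \<Omega>" "weak_solution h ?W k f" for k f
      using est[of 0 k f] that by simp
    note op = op_minus_scalar_iff_weak_solution[OF elim(2) continuous_bounded_potential[OF V]]
    have le: "l2_norm \<Omega> f \<le> 1 / c * l2_norm \<Omega> k" if "(f, k) \<in> op_minus_scalar \<Omega> (schroedinger_op \<Omega> V h) \<mu>" for f k
      using est0[of k f] that c unfolding op by (simp add: field_simps)
    have "\<mu> \<in> resolvent_set \<Omega> (schroedinger_op \<Omega> V h)"
      unfolding resolvent_set_def mem_Collect_eq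
    proof (intro conjI ballI)
      show "\<exists>C. \<forall>(f, k)\<in>op_minus_scalar \<Omega> (schroedinger_op \<Omega> V h) \<mu>. l2_norm \<Omega> f \<le> C * l2_norm \<Omega> k"
        using le by blast
      fix k assume k: "k \<in> L2 \<Omega>"
      have "\<exists>f. weak_solution h ?W k f"
        by (rule weak_solution_exists[OF elim(2) c(1) W k]) (rule est)
      then obtain f where f: "weak_solution h ?W k f" ..
      have "ae_eq \<Omega> f' f" if "weak_solution h ?W k f'" for f'
      proof -
        have "c * l2_norm \<Omega> (\<lambda>x. f' x - f x) \<le> l2_norm \<Omega> (\<lambda>x. k x - k x)"
          by (rule est0[OF L2_diff[OF k k] weak_solution_diff[OF that f W k k]])
        also have "\<dots> = 0" by (simp add: l2_norm_def)
        finally have "l2_norm \<Omega> (\<lambda>x. f' x - f x) = 0"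
          using c l2_norm_nonneg[of \<Omega> "\<lambda>x. f' x - f x"] by (simp add: mult_le_0_iff)
        then show ?thesis using l2_norm_diff_eq_0_iff weak_solution_L2[OF that] weak_solution_L2[OF f] by blast
      qed
      then show "\<exists>f. (f, k) \<in> op_minus_scalar \<Omega> (schroedinger_op \<Omega> V h) \<mu>
          \<and> (\<forall>f'. (f', k) \<in> op_minus_scalar \<Omega> (schroedinger_op \<Omega> V h) \<mu> \<longrightarrow> ae_eq \<Omega> f' f)"
        using f k unfolding op by blast
    qed
    moreover have "l2_norm \<Omega> f \<le> 1 / c"
      if "(f, k) \<in> op_minus_scalar \<Omega> (schroedinger_op \<Omega> V h) \<mu>" "l2_norm \<Omega> k \<le> 1" for f k
    proof -
      have "1 / c * l2_norm \<Omega> k \<le> 1 / c * 1" using that(2) c by (intro mult_left_mono) auto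
      then show ?thesis using le[OF that(1)] by simp
    qed
    ultimately show ?case
      by (auto simp: resolvent_norm_def spec_def intro!: SUP_least)
  qed
qed

end

theorem theorem6:
  fixes \<Omega> :: "(real ^ 'n::finite) set"
    and V :: "real ^ 'n \<Rightarrow> complex"
    and \<mu> :: complex
  assumes "open \<Omega>" and "connected \<Omega>" and "\<Omega> \<noteq> {}" and "bounded \<Omega>"
    and "continuous_on (closure \<Omega>) V"
    and "\<mu> \<notin> Phi \<Omega> V"
  shows "Limsup (at_right 0) (\<lambda>h::real. resolvent_norm \<Omega> (schroedinger_op \<Omega> V h) \<mu>)
           \<le> ereal (1 / infdist \<mu> (Phi \<Omega> V))"
proof -
  interpret bounded_domain \<Omega> by unfold_locales (use assms in auto)
  let ?d = "infdist \<mu> (Phi \<Omega> V)"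
  have "bounded (V ` closure \<Omega>)"
    using assms by (intro compact_imp_bounded compact_continuous_image) (auto simp: compact_closure)
  then have "closed (Phi \<Omega> V)" by (rule closed_Phi)
  \<comment> \<open>\<open>infdist\<close> to the empty set is 0, so positivity of the distance
    needs a point of \<open>Phi\<close>.\<close>
  moreover have "Phi \<Omega> V \<noteq> {}"
  proof -
    obtain x where "x \<in> \<Omega>" using assms(3) by blast
    then have "V x \<in> closure (V ` closure \<Omega>)" by (intro closure_subset[THEN subsetD] imageI)
    then have "V x + of_real 0 \<in> Phi \<Omega> V" unfolding Phi_def by blast
    then show ?thesis by blast
  qed
  ultimately have d: "?d > 0"
    using assms(6) in_closed_iff_infdist_zero[of "Phi \<Omega> V" \<mu>] infdist_nonneg[of \<mu> "Phi \<Omega> V"] by force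
  show ?thesis
  proof (rule ccontr)
    assume "\<not> ?thesis"
    \<comment> \<open>A number strictly between the two sides gives c = 1/r below the distance, and
      the eventual bound 1/c = r contradicts the choice of \<open>r\<close>.\<close>
    then obtain r where r: "1 / ?d < r" "ereal r < Limsup (at_right 0) (\<lambda>h. resolvent_norm \<Omega> (schroedinger_op \<Omega> V h) \<mu>)"
      using ereal_dense2[of "ereal (1 / ?d)"] by (auto simp: not_le)
    have "r > 0" using r(1) d by (meson divide_pos_pos less_trans zero_less_one)
    moreover have "1 / r < ?d" using r(1) d \<open>r > 0\<close> by (simp add: field_simps)
    ultimately have "\<forall>\<^sub>F h in at_right 0. resolvent_norm \<Omega> (schroedinger_op \<Omega> V h) \<mu> \<le> ereal (1 / (1 / r))"
      using assms(5) by (intro eventually_resolvent_norm_le[where d="?d"]) (auto intro: infdist_le)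
    from Limsup_bounded[OF this] show False using r(2) by simp
  qed
qed

end
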